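(* Let $c\ge 2$ and let $G$ be the complement of a forest on $n$ vertices with exactly $c$ components. Then $\rho(G)\ge\rho(P_{n,c})$, with equality if and only if $G\cong P_{n,c}$.
   Context: All graphs are finite and simple. For a connected graph $G$, the distance matrix is $D(G)=(d_G(u,v))_{u,v\in V(G)}$, where $d_G(u,v)$ is the length of a shortest path between $u$ and $v$; the distance spectral radius $\rho(G)$ is the largest eigenvalue of $D(G)$. $P_k$ is the path on $k$ vertices, $\overline{H}$ is the complement of $H$, $\cup$ denotes disjoint union, and $kH$ is the disjoint union of $k$ copies of $H$. For integers $n\ge 2$ and $1\le c\le n$, $$P_{n,c}=\overline{\left(c+c\lfloor\tfrac{n}{c}\rfloor-n\right)P_{\lfloor n/c\rfloor}\cup\left(n-c\lfloor\tfrac{n}{c}\rfloor\right)P_{\lceil n/c\rceil}},$$ i.e., the complement of the disjoint union of $c$ paths on $n$ vertices in total whose orders differ pairwise by at most $1$. *)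

theory Defs
  imports "Jordan_Normal_Form.Char_Poly"
begin

record 'a sgraph =
  verts :: "'a set"
  edges :: "'a set set"

definition simple_graph :: "'a sgraph \<Rightarrow> bool" where
  "simple_graph G \<longleftrightarrow> finite (verts G) \<and> (\<forall>e\<in>edges G. e \<subseteq> verts G \<and> card e = 2)"

definition graph_complement :: "'a sgraph \<Rightarrow> 'a sgraph" where
  "graph_complement G =
     \<lparr>verts = verts G, edges = {e. e \<subseteq> verts G \<and> card e = 2 \<and> e \<notin> edges G}\<rparr>"

definition path_graph :: "nat \<Rightarrow> nat sgraph" where
  "path_graph k = \<lparr>verts = {0..<k}, edges = {{i, Suc i} | i. Suc i < k}\<rparr>"

definition disjoint_union :: "'a sgraph \<Rightarrow> 'b sgraph \<Rightarrow> ('a + 'b) sgraph" where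
  "disjoint_union G H =
     \<lparr>verts = verts G <+> verts H,
      edges = (image Inl) ` edges G \<union> (image Inr) ` edges H\<rparr>"

definition copies :: "nat \<Rightarrow> 'a sgraph \<Rightarrow> (nat \<times> 'a) sgraph" where
  "copies k H =
     \<lparr>verts = {0..<k} \<times> verts H, edges = (\<Union>i<k. (image (Pair i)) ` edges H)\<rparr>"

definition graph_iso :: "'a sgraph \<Rightarrow> 'b sgraph \<Rightarrow> bool" (infix "\<cong>\<^sub>G" 50) where
  "G \<cong>\<^sub>G H \<longleftrightarrow>
     (\<exists>f. bij_betw f (verts G) (verts H) \<and>
          (\<forall>u\<in>verts G. \<forall>v\<in>verts G. {u, v} \<in> edges G \<longleftrightarrow> {f u, f v} \<in> edges H))"

definition is_path :: "'a sgraph \<Rightarrow> 'a list \<Rightarrow> bool" where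
  "is_path G p \<longleftrightarrow> p \<noteq> [] \<and> distinct p \<and> set p \<subseteq> verts G \<and>
     (\<forall>i. Suc i < length p \<longrightarrow> {p ! i, p ! Suc i} \<in> edges G)"

definition path_between :: "'a sgraph \<Rightarrow> 'a \<Rightarrow> 'a list \<Rightarrow> 'a \<Rightarrow> bool" where
  "path_between G u p v \<longleftrightarrow> is_path G p \<and> hd p = u \<and> last p = v"

definition is_cycle :: "'a sgraph \<Rightarrow> 'a list \<Rightarrow> bool" where
  "is_cycle G p \<longleftrightarrow> is_path G p \<and> length p \<ge> 3 \<and> {last p, hd p} \<in> edges G"

definition forest :: "'a sgraph \<Rightarrow> bool" where
  "forest G \<longleftrightarrow> simple_graph G \<and> (\<nexists>p. is_cycle G p)"

definition components :: "'a sgraph \<Rightarrow> 'a set set" where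
  "components G = verts G // {(u, v). \<exists>p. path_between G u p v}"

text \<open>The length of a path is its number of edges. The value is meaningful only if \<open>u\<close> and \<open>v\<close>
  lie in the same component. This suffices below: the complement of a disconnected graph is
  connected.\<close>

definition graph_dist :: "'a sgraph \<Rightarrow> 'a \<Rightarrow> 'a \<Rightarrow> nat" where
  "graph_dist G u v = (LEAST k. \<exists>p. path_between G u p v \<and> length p = Suc k)"

text \<open>The matrix type has index set \<open>{0..<n}\<close>, so the rows and columns of the distance matrix follow
  an enumeration \<open>xs\<close> of the vertices. Different enumerations give matrices that are conjugate
  under a permutation, hence the existential quantifier over \<open>xs\<close> in the spectrum.\<close>

definition distance_matrix :: "'a sgraph \<Rightarrow> 'a list \<Rightarrow> real mat" where
  "distance_matrix G xs =
     mat (length xs) (length xs) (\<lambda>(i, j). real (graph_dist G (xs ! i) (xs ! j)))"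

definition distance_eigenvalues :: "'a sgraph \<Rightarrow> real set" where
  "distance_eigenvalues G =
     {k. \<exists>xs. distinct xs \<and> set xs = verts G \<and> eigenvalue (distance_matrix G xs) k}"

definition distance_spectral_radius :: "'a sgraph \<Rightarrow> real" where
  "distance_spectral_radius G = Max (distance_eigenvalues G)"

definition P_graph :: "nat \<Rightarrow> nat \<Rightarrow> (nat \<times> nat + nat \<times> nat) sgraph" where
  "P_graph n c = graph_complement (disjoint_union
     (copies (c + c * (n div c) - n) (path_graph (n div c)))
     (copies (n - c * (n div c)) (path_graph (nat \<lceil>real n / real c\<rceil>))))"

end

theory Submission
  imports Defs
begin

text \<open>Let \<open>F\<close> be a forest with at least two components. Vertices adjacent in \<open>F\<close> have a common
  neighbour in the complement, so the distance matrix of the complement is \<open>J - I + A\<close>, where \<open>A\<close> is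
  the adjacency matrix of \<open>F\<close> and \<open>J\<close> the all-ones matrix. Its quadratic form at a vector \<open>x\<close> is determined
  by the multiset of values of \<open>x\<close>, except for the weight \<open>2 * \<Sum> x u * x v\<close> taken over the edges
  \<open>uv\<close> of \<open>F\<close>. Hence there is a comparison principle (\<open>co_radius_compare\<close>): if the values of the positive
  eigenfunction of a forest \<open>P\<close> can be placed on the vertices of \<open>F\<close> without lowering the weight, then the
  radius of \<open>F\<close> is at least that of \<open>P\<close>, and in the case of equality the placed vector solves the eigenvalue
  equations of \<open>F\<close> as well. This is used twice.

  Each tree is compared with the path of the same order (\<open>centred_path_forest_minimal\<close>). List the
  vertices of the path outwards from its centre, alternating between the two sides. The eigenfunction
  decreases along this list, and the vertex with label \<open>j\<close> is joined to the one with label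
  \<open>j - 2\<close> (both \<open>1\<close> and \<open>2\<close> are joined to \<open>0\<close>). Any tree has an enumeration in which each vertex \<open>j\<close> has a
  single earlier neighbour and this neighbour has label at most \<open>j - 2\<close>: remove leaves one at a time,
  never choosing the neighbour of the leaf removed just before while another leaf is left (\<open>peeling_order_exists\<close>). So every edge
  of the tree receives at least the weight of the corresponding edge of the path.

  Two paths whose orders differ by at least two are compared with the paths obtained by making
  the longer one shorter and the shorter one longer by one vertex (\<open>balancing_step\<close>). The
  values \<open>U\<close> and \<open>W\<close> of the eigenfunction on the two more balanced paths are placed on the original
  ones by exchanging tails. The weight gained is
  \<open>(W j - U (j - 1)) * (U j - W (j + 1))\<close>, and a sign change provides a position \<open>j\<close> at which both factors
  are nonnegative.

  In both cases equality of the radii contradicts an eigenvalue equation unless nothing has changed,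
  so the balanced paths are the only minimisers.\<close>

section \<open>Rayleigh quotients on a finite set\<close>

text \<open>The compactness needed to attain the maximum of a Rayleigh quotient. Vectors are functions
  restricted to a finite vertex set, so a convergent subsequence is extracted one coordinate at a
  time from the fact that every real sequence has a monotone subsequence.\<close>

lemma pointwise_convergent_subseq:
  fixes f :: "nat \<Rightarrow> 'v \<Rightarrow> real"
  assumes "finite V" "\<And>k v. v \<in> V \<Longrightarrow> \<bar>f k v\<bar> \<le> 1"
  shows "\<exists>r x. strict_mono r \<and> (\<forall>v\<in>V. (\<lambda>k. f (r k) v) \<longlonglongrightarrow> x v)"
  using assms
proof (induction V rule: finite_induct)
  case empty
  show ?case by (rule exI[of _ id]) (auto simp: strict_mono_def)
next
  case (insert v V)
  then obtain r x where r: "strict_mono r" "\<forall>v\<in>V. (\<lambda>k. f (r k) v) \<longlonglongrightarrow> x v"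
    by auto
  obtain s where s: "strict_mono s" "monoseq (\<lambda>k. f (r (s k)) v)"
    using seq_monosub[of "\<lambda>k. f (r k) v"] by auto
  have "Bseq (\<lambda>k. f (r (s k)) v)"
    by (rule BseqI'[of _ 1]) (use insert.prems in auto)
  then obtain l where l: "(\<lambda>k. f (r (s k)) v) \<longlonglongrightarrow> l"
    using Bseq_monoseq_convergent s convergent_def by blast
  have "(\<lambda>k. f (r (s k)) u) \<longlonglongrightarrow> x u" if "u \<in> V" for u
    using LIMSEQ_subseq_LIMSEQ[OF r(2)[rule_format, OF that] s(1)] by (simp add: o_def)
  then have "\<forall>u\<in>insert v V. (\<lambda>k. f ((r \<circ> s) k) u) \<longlonglongrightarrow> (x(v := l)) u"
    using l insert.hyps by auto
  moreover have "strict_mono (r \<circ> s)"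
    using r(1) s(1) by (rule strict_mono_o)
  ultimately show ?case by blast
qed

definition kernel_form :: "'v set \<Rightarrow> ('v \<Rightarrow> 'v \<Rightarrow> real) \<Rightarrow> ('v \<Rightarrow> real) \<Rightarrow> real" where
  "kernel_form V K x = (\<Sum>u\<in>V. \<Sum>v\<in>V. K u v * x u * x v)"

definition sq_norm_on :: "'v set \<Rightarrow> ('v \<Rightarrow> real) \<Rightarrow> real" where
  "sq_norm_on V x = (\<Sum>v\<in>V. (x v)\<^sup>2)"

definition eigenfunction :: "'v set \<Rightarrow> ('v \<Rightarrow> 'v \<Rightarrow> real) \<Rightarrow> real \<Rightarrow> ('v \<Rightarrow> real) \<Rightarrow> bool" where
  "eigenfunction V K k x \<longleftrightarrow> (\<forall>u\<in>V. (\<Sum>v\<in>V. K u v * x v) = k * x u)"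

lemma kernel_form_eigenfunction:
  "eigenfunction V K k x \<Longrightarrow> kernel_form V K x = k * sq_norm_on V x"
  unfolding eigenfunction_def kernel_form_def sq_norm_on_def sum_distrib_left
  by (rule sum.cong) (auto simp: power2_eq_square mult.assoc mult.left_commute simp flip: sum_distrib_left)

text \<open>The first-order condition at a maximum: for small \<open>t\<close> of the same sign as \<open>a\<close> the linear
  term would outweigh the quadratic one.\<close>

lemma linear_coefficient_zero:
  fixes a b :: real
  assumes "\<And>t. 2 * t * a + t\<^sup>2 * b \<le> 0"
  shows "a = 0"
proof (rule ccontr)
  assume a: "a \<noteq> 0"
  \<comment> \<open>The scale \<open>d\<close> exceeds \<open>- b\<close>, so that \<open>t = a / d\<close> is small enough.\<close>
  define d where "d = \<bar>b\<bar> + 1"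
  have d: "d > 0" "b > - d" by (auto simp: d_def)
  have "2 * (a/d) * a + (a/d)\<^sup>2 * b > 2 * (a/d) * a + (a/d)\<^sup>2 * (-d)"
    using a d by (intro add_strict_left_mono mult_strict_left_mono) auto
  moreover have "2 * (a/d) * a + (a/d)\<^sup>2 * (-d) = a\<^sup>2 / d"
    using d by (simp add: power2_eq_square field_simps)
  moreover have "a\<^sup>2 / d > 0" using a d by simp
  ultimately show False using assms[of "a/d"] by linarith
qed

text \<open>Changing the value of a maximiser at a single vertex \<open>w\<close> by \<open>t\<close> changes the defect of the
  Rayleigh inequality by a quadratic polynomial in \<open>t\<close> without constant term. Its linear coefficient
  is twice the defect of the eigenvalue equation at \<open>w\<close>, and it has to vanish.\<close>

lemma rayleigh_maximiser_eigenfunction: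
  assumes fin: "finite V" and sym: "\<And>u v. u \<in> V \<Longrightarrow> v \<in> V \<Longrightarrow> K u v = K v u"
    and le: "\<And>z. kernel_form V K z \<le> \<mu> * sq_norm_on V z"
    and eq: "kernel_form V K x = \<mu> * sq_norm_on V x"
  shows "eigenfunction V K \<mu> x"
  unfolding eigenfunction_def
proof
  fix w assume w: "w \<in> V"
  have "(\<Sum>v\<in>V. K w v * x v) - \<mu> * x w = 0"
  proof (rule linear_coefficient_zero)
    fix t :: real
    let ?h = "\<lambda>v. if v = w then t else 0"
    let ?s = "\<Sum>v\<in>V. K w v * x v"
    have e1: "(\<Sum>u\<in>V. \<Sum>v\<in>V. K u v * x u * ?h v) = t * ?s"
    proof -
      have "(\<Sum>u\<in>V. \<Sum>v\<in>V. K u v * x u * ?h v) = (\<Sum>u\<in>V. K u w * x u * t)"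
        using fin w by (intro sum.cong refl) (simp add: if_distrib[of "(*) _"] cong: if_cong)
      also have "\<dots> = (\<Sum>u\<in>V. t * (K w u * x u))"
        using sym w by (intro sum.cong) auto
      finally show ?thesis by (simp add: sum_distrib_left)
    qed
    have e2: "(\<Sum>u\<in>V. \<Sum>v\<in>V. K u v * ?h u * x v) = t * ?s"
    proof -
      have "(\<Sum>u\<in>V. \<Sum>v\<in>V. K u v * ?h u * x v) = (\<Sum>u\<in>V. if u = w then t * ?s else 0)"
        by (intro sum.cong refl) (auto simp: sum_distrib_left mult_ac)
      then show ?thesis using fin w by simp
    qed
    have e3: "(\<Sum>u\<in>V. \<Sum>v\<in>V. K u v * ?h u * ?h v) = t\<^sup>2 * K w w"
    proof -
      have "(\<Sum>u\<in>V. \<Sum>v\<in>V. K u v * ?h u * ?h v) = (\<Sum>u\<in>V. if u = w then t\<^sup>2 * K w w else 0)"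
        using fin w
        by (intro sum.cong refl) (auto simp: power2_eq_square if_distrib[of "(*) _"] cong: if_cong)
      then show ?thesis using fin w by simp
    qed
    have "kernel_form V K (\<lambda>v. x v + ?h v) =
        kernel_form V K x + (\<Sum>u\<in>V. \<Sum>v\<in>V. K u v * x u * ?h v)
        + (\<Sum>u\<in>V. \<Sum>v\<in>V. K u v * ?h u * x v) + (\<Sum>u\<in>V. \<Sum>v\<in>V. K u v * ?h u * ?h v)"
      unfolding kernel_form_def sum.distrib[symmetric]
      by (intro sum.cong refl) (simp add: algebra_simps)
    then have q: "kernel_form V K (\<lambda>v. x v + ?h v) = kernel_form V K x + 2 * t * ?s + t\<^sup>2 * K w w"
      unfolding e1 e2 e3 by simp
    have "sq_norm_on V (\<lambda>v. x v + ?h v) =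
        (\<Sum>v\<in>V. (x v)\<^sup>2 + (if v = w then 2 * t * x w + t\<^sup>2 else 0))"
      unfolding sq_norm_on_def by (intro sum.cong refl) (auto simp: power2_eq_square algebra_simps)
    then have n: "sq_norm_on V (\<lambda>v. x v + ?h v) = sq_norm_on V x + 2 * t * x w + t\<^sup>2"
      using fin w by (simp add: sum.distrib sq_norm_on_def)
    have "kernel_form V K x + 2 * t * ?s + t\<^sup>2 * K w w
        \<le> \<mu> * (sq_norm_on V x + 2 * t * x w + t\<^sup>2)"
      using le[of "\<lambda>v. x v + ?h v"] unfolding q n .
    then show "2 * t * (?s - \<mu> * x w) + t\<^sup>2 * (K w w - \<mu>) \<le> 0"
      using eq by (simp add: algebra_simps)
  qed
  then show "(\<Sum>v\<in>V. K w v * x v) = \<mu> * x w" by simp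
qed

text \<open>A limit of unit vectors whose values approach the supremum is a unit vector that attains it.
  Homogeneity then extends the bound from unit vectors to all vectors.\<close>

lemma rayleigh_maximum_attained:
  fixes K :: "'v \<Rightarrow> 'v \<Rightarrow> real"
  assumes fin: "finite V" and ne: "V \<noteq> {}"
  shows "\<exists>\<mu> x. sq_norm_on V x = 1 \<and> kernel_form V K x = \<mu> \<and>
           (\<forall>z. kernel_form V K z \<le> \<mu> * sq_norm_on V z)"
proof -
  let ?S = "kernel_form V K ` {x. sq_norm_on V x = 1}"
  have unit: "\<bar>x v\<bar> \<le> 1" if "sq_norm_on V x = 1" "v \<in> V" for x :: "'v \<Rightarrow> real" and v
  proof -
    have "(x v)\<^sup>2 \<le> sq_norm_on V x"
      unfolding sq_norm_on_def using fin that(2) by (intro member_le_sum) auto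
    then show ?thesis using that(1) by (simp add: abs_square_le_1)
  qed
  have bdd: "bdd_above ?S"
  proof (rule bdd_aboveI2)
    fix x assume x: "x \<in> {x. sq_norm_on V x = 1}"
    show "kernel_form V K x \<le> (\<Sum>u\<in>V. \<Sum>v\<in>V. \<bar>K u v\<bar>)"
      unfolding kernel_form_def
    proof (intro sum_mono)
      fix u v assume uv: "u \<in> V" "v \<in> V"
      have "\<bar>x u\<bar> * \<bar>x v\<bar> \<le> 1 * 1" using unit[of x] x uv by (intro mult_mono) auto
      then have "\<bar>K u v\<bar> * (\<bar>x u\<bar> * \<bar>x v\<bar>) \<le> \<bar>K u v\<bar> * 1"
        by (intro mult_left_mono) auto
      then have "\<bar>K u v * x u * x v\<bar> \<le> \<bar>K u v\<bar>" by (simp add: abs_mult mult.assoc)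
      then show "K u v * x u * x v \<le> \<bar>K u v\<bar>" by linarith
    qed
  qed
  obtain v0 where v0: "v0 \<in> V" using ne by auto
  have "sq_norm_on V (\<lambda>v. if v = v0 then 1 else 0) = 1"
    unfolding sq_norm_on_def using fin v0 by (simp add: if_distrib[of "\<lambda>t. t\<^sup>2"] cong: if_cong)
  then have ne': "?S \<noteq> {}" by blast
  have "\<exists>x. sq_norm_on V x = 1 \<and> Sup ?S - 1 / real (Suc k) < kernel_form V K x" for k
    using less_cSup_iff[OF ne' bdd, of "Sup ?S - 1 / real (Suc k)"] by auto
  then obtain f where f: "\<And>k. sq_norm_on V (f k) = 1"
      "\<And>k. Sup ?S - 1 / real (Suc k) < kernel_form V K (f k)"
    by metis
  obtain r x where r: "strict_mono r" and x: "\<forall>v\<in>V. (\<lambda>k. f (r k) v) \<longlonglongrightarrow> x v"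
    using pointwise_convergent_subseq[OF fin, of f] unit f(1) by blast
  have "(\<lambda>k. sq_norm_on V (f (r k))) \<longlonglongrightarrow> sq_norm_on V x"
    unfolding sq_norm_on_def using x by (intro tendsto_sum tendsto_power) auto
  then have nx: "sq_norm_on V x = 1"
    using f(1) by (simp add: LIMSEQ_const_iff)
  have q: "(\<lambda>k. kernel_form V K (f (r k))) \<longlonglongrightarrow> kernel_form V K x"
    unfolding kernel_form_def using x by (intro tendsto_sum tendsto_mult tendsto_const) auto
  have l: "(\<lambda>k. Sup ?S - 1 / real (Suc (r k))) \<longlonglongrightarrow> Sup ?S - 0"
    using LIMSEQ_subseq_LIMSEQ[OF LIMSEQ_inverse_real_of_nat r]
    by (intro tendsto_diff tendsto_const) (simp add: o_def inverse_eq_divide)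
  have ge: "Sup ?S \<le> kernel_form V K x"
    using LIMSEQ_le[OF l q] f(2) less_imp_le by auto
  have le: "kernel_form V K z \<le> kernel_form V K x" if "sq_norm_on V z = 1" for z
    using cSup_upper[OF _ bdd, of "kernel_form V K z"] that ge by auto
  have "kernel_form V K z \<le> kernel_form V K x * sq_norm_on V z" for z
  proof (cases "sq_norm_on V z = 0")
    case True
    then have "\<forall>v\<in>V. z v = 0" unfolding sq_norm_on_def using fin by (simp add: sum_nonneg_eq_0_iff)
    then have "kernel_form V K z = 0" unfolding kernel_form_def by simp
    then show ?thesis using True by simp
  next
    case False
    moreover have "sq_norm_on V z \<ge> 0" unfolding sq_norm_on_def by (simp add: sum_nonneg)
    ultimately have pos: "sq_norm_on V z > 0" by simp
    define s where "s = sqrt (sq_norm_on V z)"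
    have s: "s > 0" "s * s = sq_norm_on V z" using pos by (auto simp: s_def)
    have "sq_norm_on V (\<lambda>v. z v / s) = sq_norm_on V z / (s * s)"
      unfolding sq_norm_on_def sum_divide_distrib by (simp add: power2_eq_square)
    then have "sq_norm_on V (\<lambda>v. z v / s) = 1" using s pos by simp
    then have "kernel_form V K (\<lambda>v. z v / s) \<le> kernel_form V K x" by (rule le)
    moreover have "kernel_form V K (\<lambda>v. z v / s) = kernel_form V K z / (s * s)"
      unfolding kernel_form_def sum_divide_distrib by simp
    ultimately show ?thesis using s pos by (simp add: divide_le_eq)
  qed
  then show ?thesis using nx by blast
qed

text \<open>The right-hand side does not mention the enumeration \<open>xs\<close>. This is how the spectrum becomes
  a property of the graph alone.\<close>

lemma eigenvalue_distance_matrix: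
  assumes "distinct xs" "set xs = verts G"
  shows "eigenvalue (distance_matrix G xs) k \<longleftrightarrow>
    (\<exists>x. (\<exists>v\<in>verts G. x v \<noteq> 0) \<and> eigenfunction (verts G) (\<lambda>u v. real (graph_dist G u v)) k x)"
    (is "?L \<longleftrightarrow> ?R")
proof -
  let ?n = "length xs" and ?A = "distance_matrix G xs"
  have bij: "bij_betw ((!) xs) {0..<?n} (verts G)"
    using bij_betw_nth[OF assms(1), of "{0..<?n}" "verts G"] assms(2) by (simp add: lessThan_atLeast0)
  have dim: "dim_row ?A = ?n" "dim_col ?A = ?n" by (auto simp: distance_matrix_def)
  have entry: "(?A *\<^sub>v vec ?n (\<lambda>i. x (xs ! i))) $ i = (\<Sum>v\<in>verts G. real (graph_dist G (xs ! i) v) * x v)"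
    if "i < ?n" for i and x :: "'a \<Rightarrow> real"
  proof -
    have "(?A *\<^sub>v vec ?n (\<lambda>i. x (xs ! i))) $ i =
        (\<Sum>j\<in>{0..<?n}. real (graph_dist G (xs ! i) (xs ! j)) * x (xs ! j))"
      using that dim by (simp add: scalar_prod_def distance_matrix_def)
    also have "\<dots> = (\<Sum>v\<in>verts G. real (graph_dist G (xs ! i) v) * x v)"
      using sum.reindex_bij_betw[OF bij, of "\<lambda>v. real (graph_dist G (xs ! i) v) * x v"] by simp
    finally show ?thesis .
  qed
  show ?thesis
  proof
    assume ?L
    then obtain v where v: "v \<in> carrier_vec ?n" "v \<noteq> 0\<^sub>v ?n" "?A *\<^sub>v v = k \<cdot>\<^sub>v v"
      unfolding eigenvalue_def eigenvector_def dim by auto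
    define x where "x u = v $ (inv_into {0..<?n} ((!) xs) u)" for u
    have xi: "x (xs ! i) = v $ i" if "i < ?n" for i
      unfolding x_def using bij_betw_inv_into_left[OF bij, of i] that by simp
    have vx: "vec ?n (\<lambda>i. x (xs ! i)) = v"
      using v(1) xi by (intro eq_vecI) auto
    have "\<exists>i<?n. v $ i \<noteq> 0"
    proof (rule ccontr)
      assume "\<not> (\<exists>i<?n. v $ i \<noteq> 0)"
      then have "v = 0\<^sub>v ?n" using v(1) by (intro eq_vecI) auto
      then show False using v(2) by simp
    qed
    then have "\<exists>u\<in>verts G. x u \<noteq> 0" using xi assms(2) nth_mem by metis
    moreover have "(\<Sum>u\<in>verts G. real (graph_dist G w u) * x u) = k * x w" if w: "w \<in> verts G" for w
    proof -
      obtain i where i: "i < ?n" "w = xs ! i" using w assms(2) by (metis in_set_conv_nth)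
      have "(?A *\<^sub>v v) $ i = k * v $ i" using v i by simp
      then show ?thesis using entry[OF i(1), of x] i vx xi by simp
    qed
    ultimately show ?R unfolding eigenfunction_def by blast
  next
    assume ?R
    then obtain x where x: "\<exists>v\<in>verts G. x v \<noteq> 0"
      "\<And>u. u \<in> verts G \<Longrightarrow> (\<Sum>v\<in>verts G. real (graph_dist G u v) * x v) = k * x u"
      unfolding eigenfunction_def by auto
    let ?v = "vec ?n (\<lambda>i. x (xs ! i))"
    have "?v \<noteq> 0\<^sub>v ?n"
    proof
      assume 0: "?v = 0\<^sub>v ?n"
      obtain i where i: "i < ?n" "x (xs ! i) \<noteq> 0" using x(1) assms(2) by (metis in_set_conv_nth)
      have "?v $ i = 0" unfolding 0 using i by simp
      then show False using i by simp
    qed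
    moreover have "?A *\<^sub>v ?v = k \<cdot>\<^sub>v ?v"
    proof (rule eq_vecI)
      show "dim_vec (?A *\<^sub>v ?v) = dim_vec (k \<cdot>\<^sub>v ?v)" using dim by simp
      fix i assume "i < dim_vec (k \<cdot>\<^sub>v ?v)"
      then have i: "i < ?n" by simp
      have m: "xs ! i \<in> verts G" using nth_mem[OF i] unfolding assms(2) .
      show "(?A *\<^sub>v ?v) $ i = (k \<cdot>\<^sub>v ?v) $ i"
        using i by (simp only: entry[OF i] x(2)[OF m] index_smult_vec index_vec dim_vec)
    qed
    ultimately show ?L unfolding eigenvalue_def eigenvector_def dim
      by (intro exI[of _ ?v]) simp
  qed
qed

text \<open>The maximum of the Rayleigh quotient is an eigenvalue, and evaluating the quotient at an
  eigenvector shows that it bounds every other eigenvalue. The maximum in the definition of the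
  spectral radius exists because only finitely many enumerations occur and each characteristic
  polynomial has finitely many roots.\<close>

lemma distance_spectral_radius_rayleigh:
  assumes fin: "finite (verts G)" and ne: "verts G \<noteq> {}"
    and sym: "\<And>u v. u \<in> verts G \<Longrightarrow> v \<in> verts G \<Longrightarrow> graph_dist G u v = graph_dist G v u"
  defines "K \<equiv> \<lambda>u v. real (graph_dist G u v)"
  shows "kernel_form (verts G) K z \<le> distance_spectral_radius G * sq_norm_on (verts G) z"
    and "\<exists>x. sq_norm_on (verts G) x = 1 \<and> kernel_form (verts G) K x = distance_spectral_radius G"
proof -
  let ?V = "verts G"
  obtain \<mu> x where x: "sq_norm_on ?V x = 1" "kernel_form ?V K x = \<mu>"
    and le: "\<And>z. kernel_form ?V K z \<le> \<mu> * sq_norm_on ?V z"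
    using rayleigh_maximum_attained[OF fin ne, of K] by auto
  have e: "eigenfunction ?V K \<mu> x"
    by (rule rayleigh_maximiser_eigenfunction[OF fin]) (use sym x le in \<open>auto simp: K_def\<close>)
  have nz: "\<exists>v\<in>?V. x v \<noteq> 0"
  proof (rule ccontr)
    assume "\<not> ?thesis"
    then have "sq_norm_on ?V x = 0" unfolding sq_norm_on_def by simp
    then show False using x by simp
  qed
  have "distance_eigenvalues G \<subseteq>
      (\<Union>xs\<in>{xs. set xs = ?V \<and> distinct xs}. {k. poly (char_poly (distance_matrix G xs)) k = 0})"
  proof
    fix k assume "k \<in> distance_eigenvalues G"
    then obtain xs where xs: "distinct xs" "set xs = ?V" "eigenvalue (distance_matrix G xs) k"
      unfolding distance_eigenvalues_def by blast
    have "distance_matrix G xs \<in> carrier_mat (length xs) (length xs)"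
      by (simp add: distance_matrix_def)
    then have "poly (char_poly (distance_matrix G xs)) k = 0"
      using eigenvalue_root_char_poly xs(3) by blast
    then show "k \<in> (\<Union>xs\<in>{xs. set xs = ?V \<and> distinct xs}. {k. poly (char_poly (distance_matrix G xs)) k = 0})"
      using xs by blast
  qed
  moreover have "finite {xs. set xs = ?V \<and> distinct xs}"
    by (rule finite_subset[OF _ finite_subset_distinct[OF fin]]) auto
  moreover have "finite {k. poly (char_poly (distance_matrix G xs)) k = 0}" for xs
  proof (rule poly_roots_finite)
    have "distance_matrix G xs \<in> carrier_mat (length xs) (length xs)"
      by (simp add: distance_matrix_def)
    from degree_monic_char_poly[OF this] show "char_poly (distance_matrix G xs) \<noteq> 0" by auto
  qed
  ultimately have finE: "finite (distance_eigenvalues G)"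
    by (meson finite_UN_I finite_subset)
  have upper: "k \<le> \<mu>" if k: "k \<in> distance_eigenvalues G" for k
  proof -
    obtain w where w: "\<exists>v\<in>?V. w v \<noteq> 0" "eigenfunction ?V K k w"
      using k eigenvalue_distance_matrix unfolding distance_eigenvalues_def K_def by blast
    have pos: "sq_norm_on ?V w > 0"
      unfolding sq_norm_on_def using w(1) fin by (auto intro: sum_pos2)
    have "k * sq_norm_on ?V w \<le> \<mu> * sq_norm_on ?V w"
      using le[of w] kernel_form_eigenfunction[OF w(2)] by simp
    then show ?thesis using pos by simp
  qed
  have "\<mu> \<in> distance_eigenvalues G"
  proof -
    obtain xs where xs: "set xs = ?V" "distinct xs" using finite_distinct_list[OF fin] by auto
    then have "eigenvalue (distance_matrix G xs) \<mu>"
      using eigenvalue_distance_matrix[OF xs(2,1)] e nz unfolding K_def by blast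
    then show ?thesis using xs unfolding distance_eigenvalues_def by blast
  qed
  then have "distance_spectral_radius G = \<mu>"
    unfolding distance_spectral_radius_def using finE upper by (intro Max_eqI) auto
  then show "kernel_form ?V K z \<le> distance_spectral_radius G * sq_norm_on ?V z"
    "\<exists>x. sq_norm_on ?V x = 1 \<and> kernel_form ?V K x = distance_spectral_radius G"
    using le x by auto
qed

section \<open>Distances in the complement of a graph\<close>

text \<open>Every forest with at least two components has this property, since \<open>w\<close> can be taken from a
  component that does not contain the edge. The vertex \<open>w\<close> is a common neighbour of \<open>u\<close> and \<open>v\<close> in the
  complement, so two vertices that are adjacent in \<open>F\<close> are at distance exactly \<open>2\<close> there.\<close>

definition no_dominating_edge :: "'a sgraph \<Rightarrow> bool" where
  "no_dominating_edge F \<longleftrightarrow> simple_graph F \<and> verts F \<noteq> {} \<and>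
     (\<forall>u v. {u, v} \<in> edges F \<longrightarrow> (\<exists>w\<in>verts F. {u, w} \<notin> edges F \<and> {v, w} \<notin> edges F))"

lemma simple_graph_edgeD:
  assumes "simple_graph F" "{u, v} \<in> edges F"
  shows "u \<in> verts F" "v \<in> verts F" "u \<noteq> v"
proof -
  have "{u, v} \<subseteq> verts F" "card {u, v} = 2" using assms unfolding simple_graph_def by blast+
  then show "u \<in> verts F" "v \<in> verts F" "u \<noteq> v" by auto
qed

definition co_dist :: "'a sgraph \<Rightarrow> 'a \<Rightarrow> 'a \<Rightarrow> real" where
  "co_dist F u v = (if u = v then 0 else if {u, v} \<in> edges F then 2 else 1)"

lemma verts_complement [simp]: "verts (graph_complement F) = verts F"
  by (simp add: graph_complement_def)

lemma edge_complement_iff: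
  "{u, v} \<in> edges (graph_complement F) \<longleftrightarrow>
     u \<in> verts F \<and> v \<in> verts F \<and> u \<noteq> v \<and> {u, v} \<notin> edges F"
  by (auto simp: graph_complement_def card_insert_if)

lemma graph_dist_complement:
  assumes F: "no_dominating_edge F" and uv: "u \<in> verts F" "v \<in> verts F"
  shows "real (graph_dist (graph_complement F) u v) = co_dist F u v"
proof -
  let ?G = "graph_complement F"
  let ?P = "\<lambda>k. \<exists>p. path_between ?G u p v \<and> length p = Suc k"
  have zero: "?P 0 \<longleftrightarrow> u = v"
  proof
    assume "?P 0"
    then show "u = v" by (auto simp: path_between_def length_Suc_conv)
  next
    assume "u = v"
    then have "path_between ?G u [u] v" using uv by (simp add: path_between_def is_path_def)
    then show "?P 0" by force
  qed
  have one: "{u, v} \<in> edges ?G" if one: "?P 1"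
  proof -
    obtain p where p: "path_between ?G u p v" "length p = 2" using one by auto
    then obtain a b where ab: "p = [a, b]" by (auto simp: length_Suc_conv numeral_2_eq_2)
    then show ?thesis using p by (auto simp: path_between_def is_path_def)
  qed
  have least: "graph_dist ?G u v = (LEAST k. ?P k)" unfolding graph_dist_def ..
  consider "u = v" | "u \<noteq> v" "{u, v} \<notin> edges F" | "u \<noteq> v" "{u, v} \<in> edges F" by blast
  then show ?thesis
  proof cases
    case 1
    then have "(LEAST k. ?P k) = 0" using zero by (intro Least_equality) auto
    then show ?thesis using 1 least by (simp add: co_dist_def)
  next
    case 2
    have "path_between ?G u [u, v] v"
      using 2 uv by (simp add: path_between_def is_path_def edge_complement_iff less_Suc_eq)
    then have "?P 1" by force
    then have "(LEAST k. ?P k) = 1"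
    proof (rule Least_equality)
      fix k assume "?P k"
      then show "1 \<le> k" using zero 2 by (cases k) auto
    qed
    then show ?thesis using 2 least by (simp add: co_dist_def)
  next
    case 3
    obtain w where w: "w \<in> verts F" "{u, w} \<notin> edges F" "{v, w} \<notin> edges F"
      using F 3 unfolding no_dominating_edge_def by blast
    then have "w \<noteq> u" "w \<noteq> v" using 3 by (auto simp: insert_commute)
    then have "path_between ?G u [u, w, v] v"
      using 3 uv w by (auto simp: path_between_def is_path_def edge_complement_iff less_Suc_eq insert_commute)
    then have "?P 2" by (intro exI[of _ "[u, w, v]"]) simp
    then have "(LEAST k. ?P k) = 2"
    proof (rule Least_equality)
      fix k assume k: "?P k"
      have "k \<noteq> 0" using k zero 3 by (cases k) auto
      moreover have "k \<noteq> 1" using k one 3 edge_complement_iff by metis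
      ultimately show "2 \<le> k" by simp
    qed
    then show ?thesis using 3 least by (simp add: co_dist_def)
  qed
qed

definition nbr_sum :: "'a sgraph \<Rightarrow> ('a \<Rightarrow> real) \<Rightarrow> 'a \<Rightarrow> real" where
  "nbr_sum F x u = (\<Sum>v | v \<in> verts F \<and> {u, v} \<in> edges F. x v)"

definition adj_form :: "'a sgraph \<Rightarrow> ('a \<Rightarrow> real) \<Rightarrow> real" where
  "adj_form F x = (\<Sum>u\<in>verts F. x u * nbr_sum F x u)"

definition co_radius :: "'a sgraph \<Rightarrow> real" where
  "co_radius F = distance_spectral_radius (graph_complement F)"

text \<open>With \<open>A\<close> the adjacency matrix of \<open>F\<close> and \<open>J\<close> the all-ones matrix, the distance matrix of the
  complement is \<open>J - I + A\<close>. The equation below is the eigenvalue equation for \<open>J + A\<close>, which is why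
  the eigenvalue is increased by one.\<close>

definition co_eigenfunction :: "'a sgraph \<Rightarrow> ('a \<Rightarrow> real) \<Rightarrow> bool" where
  "co_eigenfunction F x \<longleftrightarrow>
     (\<forall>u\<in>verts F. sum x (verts F) + nbr_sum F x u = (co_radius F + 1) * x u)"

lemma co_dist_row:
  assumes F: "simple_graph F" and u: "u \<in> verts F"
  shows "(\<Sum>v\<in>verts F. co_dist F u v * x v) = sum x (verts F) + nbr_sum F x u - x u"
proof -
  have fin: "finite (verts F)" using F by (simp add: simple_graph_def)
  have "{u} \<notin> edges F" using F unfolding simple_graph_def by force
  then have "(\<Sum>v\<in>verts F. co_dist F u v * x v) =
      (\<Sum>v\<in>verts F. x v + (if {u, v} \<in> edges F then x v else 0) - (if v = u then x u else 0))"
    by (intro sum.cong refl) (auto simp: co_dist_def)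
  also have "\<dots> = sum x (verts F) + nbr_sum F x u - x u"
    using fin u by (simp add: sum.distrib sum_subtractf nbr_sum_def sum.inter_filter)
  finally show ?thesis .
qed

text \<open>Only the summand \<open>adj_form F x\<close> depends on the edges. The others depend only on the multiset of
  values of \<open>x\<close>, so two graphs can be compared by carrying the values of a vector over to the
  vertices of the other graph.\<close>

lemma co_dist_form:
  assumes F: "simple_graph F"
  shows "kernel_form (verts F) (co_dist F) x =
    (sum x (verts F))\<^sup>2 + adj_form F x - sq_norm_on (verts F) x"
proof -
  have "kernel_form (verts F) (co_dist F) x = (\<Sum>u\<in>verts F. x u * (\<Sum>v\<in>verts F. co_dist F u v * x v))"
    unfolding kernel_form_def sum_distrib_left by (simp add: mult_ac)
  also have "\<dots> = (\<Sum>u\<in>verts F. x u * sum x (verts F) + x u * nbr_sum F x u - (x u)\<^sup>2)"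
    by (intro sum.cong refl) (simp add: co_dist_row[OF F] right_diff_distrib distrib_left power2_eq_square)
  also have "\<dots> = (sum x (verts F))\<^sup>2 + adj_form F x - sq_norm_on (verts F) x"
    by (simp add: sum.distrib sum_subtractf adj_form_def sq_norm_on_def power2_eq_square sum_distrib_right)
  finally show ?thesis .
qed

lemma co_eigenfunction_iff:
  assumes "simple_graph F"
  shows "co_eigenfunction F x \<longleftrightarrow> eigenfunction (verts F) (co_dist F) (co_radius F) x"
  unfolding co_eigenfunction_def eigenfunction_def
  by (rule ball_cong) (auto simp: co_dist_row[OF assms] distrib_right)

lemma co_radius_rayleigh:
  assumes F: "no_dominating_edge F"
  shows "kernel_form (verts F) (co_dist F) z \<le> co_radius F * sq_norm_on (verts F) z"
    and "\<exists>x. sq_norm_on (verts F) x = 1 \<and> kernel_form (verts F) (co_dist F) x = co_radius F"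
proof -
  let ?G = "graph_complement F"
  have V: "finite (verts ?G)" "verts ?G \<noteq> {}"
    using F by (auto simp: no_dominating_edge_def simple_graph_def)
  have "real (graph_dist ?G u v) = real (graph_dist ?G v u)" if "u \<in> verts ?G" "v \<in> verts ?G" for u v
    using that graph_dist_complement[OF F] by (simp add: co_dist_def insert_commute)
  then have sym: "graph_dist ?G u v = graph_dist ?G v u" if "u \<in> verts ?G" "v \<in> verts ?G" for u v
    using that by simp
  have form: "kernel_form (verts ?G) (\<lambda>u v. real (graph_dist ?G u v)) x = kernel_form (verts F) (co_dist F) x" for x
    unfolding kernel_form_def using graph_dist_complement[OF F] by (auto intro!: sum.cong)
  show "kernel_form (verts F) (co_dist F) z \<le> co_radius F * sq_norm_on (verts F) z"
    using distance_spectral_radius_rayleigh(1)[OF V sym, of z] by (simp add: form[simplified] co_radius_def)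
  show "\<exists>x. sq_norm_on (verts F) x = 1 \<and> kernel_form (verts F) (co_dist F) x = co_radius F"
    using distance_spectral_radius_rayleigh(2)[OF V sym] by (simp add: form[simplified] co_radius_def)
qed

lemma co_radius_maximiser:
  assumes F: "no_dominating_edge F"
    and eq: "kernel_form (verts F) (co_dist F) x = co_radius F * sq_norm_on (verts F) x"
  shows "co_eigenfunction F x"
proof -
  have s: "simple_graph F" using F by (simp add: no_dominating_edge_def)
  have "finite (verts F)" using s by (simp add: simple_graph_def)
  then have "eigenfunction (verts F) (co_dist F) (co_radius F) x"
    by (rule rayleigh_maximiser_eigenfunction)
      (use co_radius_rayleigh(1)[OF F] eq in \<open>auto simp: co_dist_def insert_commute\<close>)
  then show ?thesis using co_eigenfunction_iff[OF s] by simp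
qed

text \<open>All entries of the distance matrix are nonnegative, so the absolute value of a maximiser is again
  a maximiser. It is positive everywhere because in the eigenvalue equation the term \<open>sum x\<close> contributes the
  same positive amount at every vertex.\<close>

lemma positive_co_eigenfunction:
  assumes F: "no_dominating_edge F"
  shows "\<exists>y. (\<forall>v\<in>verts F. y v > 0) \<and> co_eigenfunction F y"
proof -
  have fin: "finite (verts F)" using F by (simp add: no_dominating_edge_def simple_graph_def)
  obtain x where x: "sq_norm_on (verts F) x = 1" "kernel_form (verts F) (co_dist F) x = co_radius F"
    using co_radius_rayleigh(2)[OF F] by blast
  let ?y = "\<lambda>v. \<bar>x v\<bar>"
  have ny: "sq_norm_on (verts F) ?y = 1" using x(1) by (simp add: sq_norm_on_def)
  have "kernel_form (verts F) (co_dist F) x \<le> kernel_form (verts F) (co_dist F) ?y"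
    unfolding kernel_form_def
  proof (intro sum_mono)
    fix u v
    have "co_dist F u v * x u * x v \<le> \<bar>co_dist F u v * x u * x v\<bar>" by simp
    also have "\<dots> = co_dist F u v * \<bar>x u\<bar> * \<bar>x v\<bar>" by (simp add: abs_mult co_dist_def)
    finally show "co_dist F u v * x u * x v \<le> co_dist F u v * \<bar>x u\<bar> * \<bar>x v\<bar>" .
  qed
  then have "kernel_form (verts F) (co_dist F) ?y = co_radius F * sq_norm_on (verts F) ?y"
    using co_radius_rayleigh(1)[OF F, of ?y] x(2) ny by simp
  then have e: "co_eigenfunction F ?y" by (rule co_radius_maximiser[OF F])
  have "\<exists>v\<in>verts F. ?y v \<noteq> 0"
  proof (rule ccontr)
    assume "\<not> ?thesis"
    then have "sq_norm_on (verts F) x = 0" unfolding sq_norm_on_def by simp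
    then show False using x by simp
  qed
  then have S: "sum ?y (verts F) > 0" using fin by (auto intro: sum_pos2)
  have pos: "?y v > 0" if v: "v \<in> verts F" for v
  proof -
    have "nbr_sum F ?y v \<ge> 0" unfolding nbr_sum_def by (intro sum_nonneg) auto
    then have "(co_radius F + 1) * ?y v > 0" using e v S unfolding co_eigenfunction_def by force
    then have "?y v \<noteq> 0" by force
    then show ?thesis by simp
  qed
  show ?thesis by (intro exI[of _ ?y] conjI ballI pos e)
qed

text \<open>The comparison principle behind every inequality below. If the values of a positive
  eigenfunction of \<open>P\<close> are rearranged on \<open>F\<close> to a vector \<open>z\<close> without losing adjacency weight, then the
  Rayleigh quotient of \<open>z\<close> is at least the radius of \<open>P\<close>. If the radii agree, \<open>z\<close> is itself a maximiser
  and hence satisfies the eigenvalue equations of \<open>F\<close>; each strict inequality comes from contradicting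
  one of these equations.\<close>

lemma co_radius_compare:
  assumes F: "no_dominating_edge F" and P: "no_dominating_edge P"
    and y: "co_eigenfunction P y" "\<forall>v\<in>verts P. y v > 0"
    and s: "sum z (verts F) = sum y (verts P)"
    and n: "sq_norm_on (verts F) z = sq_norm_on (verts P) y"
    and a: "adj_form P y \<le> adj_form F z"
  shows "co_radius P \<le> co_radius F"
    and "co_radius F = co_radius P \<Longrightarrow> co_eigenfunction F z"
proof -
  have sF: "simple_graph F" and sP: "simple_graph P" and fin: "finite (verts P)" "verts P \<noteq> {}"
    using F P by (auto simp: no_dominating_edge_def simple_graph_def)
  have pos: "sq_norm_on (verts P) y > 0"
    unfolding sq_norm_on_def using fin y(2) by (intro sum_pos) auto
  have "kernel_form (verts P) (co_dist P) y = co_radius P * sq_norm_on (verts P) y"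
    using y(1) by (simp add: co_eigenfunction_iff[OF sP] kernel_form_eigenfunction)
  moreover have "kernel_form (verts P) (co_dist P) y \<le> kernel_form (verts F) (co_dist F) z"
    using s n a by (simp add: co_dist_form sF sP)
  ultimately have le: "co_radius P * sq_norm_on (verts P) y \<le> kernel_form (verts F) (co_dist F) z" by simp
  moreover have ub: "kernel_form (verts F) (co_dist F) z \<le> co_radius F * sq_norm_on (verts P) y"
    using co_radius_rayleigh(1)[OF F, of z] n by simp
  ultimately have "co_radius P * sq_norm_on (verts P) y \<le> co_radius F * sq_norm_on (verts P) y" by simp
  then show "co_radius P \<le> co_radius F" using pos by simp
  assume "co_radius F = co_radius P"
  then show "co_eigenfunction F z" using le ub n by (intro co_radius_maximiser[OF F]) simp
qed

section \<open>Isomorphism and complement\<close>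

lemma graph_iso_sym:
  assumes "F \<cong>\<^sub>G H"
  shows "H \<cong>\<^sub>G F"
proof -
  obtain f where f: "bij_betw f (verts F) (verts H)"
    "\<And>u v. u \<in> verts F \<Longrightarrow> v \<in> verts F \<Longrightarrow> {u, v} \<in> edges F \<longleftrightarrow> {f u, f v} \<in> edges H"
    using assms unfolding graph_iso_def by blast
  let ?g = "inv_into (verts F) f"
  have "{u, v} \<in> edges H \<longleftrightarrow> {?g u, ?g v} \<in> edges F" if "u \<in> verts H" "v \<in> verts H" for u v
    using that f(2)[of "?g u" "?g v"] bij_betw_inv_into_right[OF f(1)] bij_betw_inv_into[OF f(1)]
    by (simp add: bij_betw_apply)
  then show ?thesis unfolding graph_iso_def using bij_betw_inv_into[OF f(1)] by blast
qed

lemma graph_iso_trans: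
  assumes "F \<cong>\<^sub>G H" "H \<cong>\<^sub>G L"
  shows "F \<cong>\<^sub>G L"
proof -
  obtain f where f: "bij_betw f (verts F) (verts H)"
    "\<And>u v. u \<in> verts F \<Longrightarrow> v \<in> verts F \<Longrightarrow> {u, v} \<in> edges F \<longleftrightarrow> {f u, f v} \<in> edges H"
    using assms unfolding graph_iso_def by blast
  obtain g where g: "bij_betw g (verts H) (verts L)"
    "\<And>u v. u \<in> verts H \<Longrightarrow> v \<in> verts H \<Longrightarrow> {u, v} \<in> edges H \<longleftrightarrow> {g u, g v} \<in> edges L"
    using assms unfolding graph_iso_def by blast
  show ?thesis unfolding graph_iso_def
    by (intro exI[of _ "g \<circ> f"] conjI bij_betw_trans[OF f(1) g(1)])
      (simp add: f(2) g(2) bij_betw_apply[OF f(1)])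
qed

lemma graph_iso_complement:
  assumes iso: "F \<cong>\<^sub>G H"
  shows "graph_complement F \<cong>\<^sub>G graph_complement H"
proof -
  obtain f where f: "bij_betw f (verts F) (verts H)"
    "\<And>u v. u \<in> verts F \<Longrightarrow> v \<in> verts F \<Longrightarrow> {u, v} \<in> edges F \<longleftrightarrow> {f u, f v} \<in> edges H"
    using iso unfolding graph_iso_def by blast
  have "f u = f v \<longleftrightarrow> u = v" if "u \<in> verts F" "v \<in> verts F" for u v
    using f(1) that by (meson bij_betw_imp_inj_on inj_on_eq_iff)
  then show ?thesis unfolding graph_iso_def
    by (intro exI[of _ f]) (auto simp: f edge_complement_iff bij_betw_apply[OF f(1)])
qed

lemma complement_complement:
  assumes "simple_graph F"
  shows "graph_complement (graph_complement F) = F"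
  using assms by (cases F) (auto simp: graph_complement_def simple_graph_def)

lemma no_dominating_edge_iso:
  assumes F: "no_dominating_edge F" and iso: "F \<cong>\<^sub>G H" and H: "simple_graph H"
  shows "no_dominating_edge H"
  unfolding no_dominating_edge_def
proof (intro conjI allI impI)
  obtain f where f: "bij_betw f (verts H) (verts F)"
    "\<And>u v. u \<in> verts H \<Longrightarrow> v \<in> verts H \<Longrightarrow> {u, v} \<in> edges H \<longleftrightarrow> {f u, f v} \<in> edges F"
    using graph_iso_sym[OF iso] unfolding graph_iso_def by blast
  show "verts H \<noteq> {}" using F f(1) by (auto simp: no_dominating_edge_def bij_betw_def)
  fix u v assume e: "{u, v} \<in> edges H"
  note uv = simple_graph_edgeD[OF H e]
  obtain w where w: "w \<in> verts F" "{f u, w} \<notin> edges F" "{f v, w} \<notin> edges F"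
    using F f(2)[of u v] uv e unfolding no_dominating_edge_def by blast
  obtain w' where w': "w' \<in> verts H" "w = f w'" using w(1) f(1) by (auto simp: bij_betw_def)
  show "\<exists>w\<in>verts H. {u, w} \<notin> edges H \<and> {v, w} \<notin> edges H"
    using w w' uv f(2) by blast
qed (rule H)

text \<open>An isomorphism transports eigenfunctions, so this is the comparison principle without any change of
  weight.\<close>

lemma co_radius_iso_le:
  assumes F: "no_dominating_edge F" and P: "no_dominating_edge P" and iso: "F \<cong>\<^sub>G P"
  shows "co_radius P \<le> co_radius F"
proof -
  obtain f where f: "bij_betw f (verts F) (verts P)"
    "\<And>u v. u \<in> verts F \<Longrightarrow> v \<in> verts F \<Longrightarrow> {u, v} \<in> edges F \<longleftrightarrow> {f u, f v} \<in> edges P"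
    using iso unfolding graph_iso_def by blast
  obtain y where y: "\<forall>v\<in>verts P. y v > 0" "co_eigenfunction P y"
    using positive_co_eigenfunction[OF P] by blast
  have nb: "nbr_sum F (y \<circ> f) u = nbr_sum P y (f u)" if u: "u \<in> verts F" for u
    unfolding nbr_sum_def
  proof (rule sum.reindex_bij_betw[of f _ _ y, unfolded comp_def[symmetric]])
    show "bij_betw f {v. v \<in> verts F \<and> {u, v} \<in> edges F} {v. v \<in> verts P \<and> {f u, v} \<in> edges P}"
      unfolding bij_betw_def
    proof
      show "inj_on f {v. v \<in> verts F \<and> {u, v} \<in> edges F}"
        using f(1) by (auto simp: bij_betw_def inj_on_def)
      have "verts P = f ` verts F" using f(1) by (simp add: bij_betw_def)
      then show "f ` {v. v \<in> verts F \<and> {u, v} \<in> edges F} = {v. v \<in> verts P \<and> {f u, v} \<in> edges P}"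
        using f(2)[OF u] by auto
    qed
  qed
  show ?thesis
  proof (rule co_radius_compare(1)[OF F P y(2,1), of "y \<circ> f"])
    show "sum (y \<circ> f) (verts F) = sum y (verts P)"
      using sum.reindex_bij_betw[OF f(1), of y] by (simp add: o_def)
    show "sq_norm_on (verts F) (y \<circ> f) = sq_norm_on (verts P) y"
      using sum.reindex_bij_betw[OF f(1), of "\<lambda>v. (y v)\<^sup>2"] by (simp add: sq_norm_on_def)
    show "adj_form P y \<le> adj_form F (y \<circ> f)"
      using sum.reindex_bij_betw[OF f(1), of "\<lambda>v. y v * nbr_sum P y v"] nb
      by (simp add: adj_form_def)
  qed
qed

lemma co_radius_iso:
  assumes "no_dominating_edge F" "no_dominating_edge P" "F \<cong>\<^sub>G P"
  shows "co_radius F = co_radius P"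
  using co_radius_iso_le[OF assms] co_radius_iso_le[OF assms(2,1) graph_iso_sym[OF assms(3)]] by simp

section \<open>Forests given by parent functions\<close>

text \<open>A normal form for forests with \<open>c\<close> components of orders \<open>m 0, \<dots>, m (c - 1)\<close>. The vertices of
  component \<open>i\<close> are the pairs \<open>(i, j)\<close> with \<open>j < m i\<close>, and every vertex except the root \<open>(i, 0)\<close>
  is joined to its parent \<open>(i, p i j)\<close>.\<close>

definition parent_forest :: "nat \<Rightarrow> (nat \<Rightarrow> nat) \<Rightarrow> (nat \<Rightarrow> nat \<Rightarrow> nat) \<Rightarrow> (nat \<times> nat) sgraph" where
  "parent_forest c m p =
     \<lparr>verts = (SIGMA i:{..<c}. {..<m i}),
      edges = {{(i, j), (i, p i j)} | i j. i < c \<and> 0 < j \<and> j < m i}\<rparr>"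

definition parent_fun :: "nat \<Rightarrow> (nat \<Rightarrow> nat) \<Rightarrow> (nat \<Rightarrow> nat \<Rightarrow> nat) \<Rightarrow> bool" where
  "parent_fun c m p \<longleftrightarrow> (\<forall>i<c. \<forall>j<m i. 0 < j \<longrightarrow> p i j < j)"

abbreviation path_forest :: "nat \<Rightarrow> (nat \<Rightarrow> nat) \<Rightarrow> (nat \<times> nat) sgraph" where
  "path_forest c m \<equiv> parent_forest c m (\<lambda>i j. j - 1)"

text \<open>The same paths with labels that alternate outwards from the centre \<open>0\<close>: the truncated subtraction
  gives both \<open>1\<close> and \<open>2\<close> the parent \<open>0\<close>, after which the odd and the even labels run along the two
  halves, as in \<open>\<dots> 5 3 1 0 2 4 6 \<dots>\<close>.\<close>

abbreviation centred_path_forest :: "nat \<Rightarrow> (nat \<Rightarrow> nat) \<Rightarrow> (nat \<times> nat) sgraph" where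
  "centred_path_forest c m \<equiv> parent_forest c m (\<lambda>i j. j - 2)"

lemma verts_parent_forest: "verts (parent_forest c m p) = (SIGMA i:{..<c}. {..<m i})"
  by (simp add: parent_forest_def)

lemma sum_parent_forest:
  "sum f (verts (parent_forest c m p)) = (\<Sum>i<c. \<Sum>j<m i. f (i, j))"
  unfolding verts_parent_forest by (simp add: sum.Sigma)

lemma edge_parent_forest_iff:
  "{(i, j), (i', k)} \<in> edges (parent_forest c m p) \<longleftrightarrow>
    i' = i \<and> i < c \<and> (0 < j \<and> j < m i \<and> k = p i j \<or> 0 < k \<and> k < m i \<and> j = p i k)"
  by (auto simp: parent_forest_def doubleton_eq_iff)

lemma parent_forest_simple:
  assumes "parent_fun c m p"
  shows "simple_graph (parent_forest c m p)"
  using assms unfolding simple_graph_def parent_fun_def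
  by (auto simp: parent_forest_def card_insert_if) force+

lemma parent_forest_no_dominating_edge:
  assumes "parent_fun c m p" "c \<ge> 2" "\<And>i. i < c \<Longrightarrow> m i \<ge> 1"
  shows "no_dominating_edge (parent_forest c m p)"
  unfolding no_dominating_edge_def
proof (intro conjI allI impI)
  let ?F = "parent_forest c m p"
  show "simple_graph ?F" using assms(1) by (rule parent_forest_simple)
  have "(0, 0) \<in> verts ?F" using assms(2) assms(3)[of 0] by (simp add: verts_parent_forest)
  then show "verts ?F \<noteq> {}" by blast
  fix u v assume uv: "{u, v} \<in> edges ?F"
  obtain i j i' k where u: "u = (i, j)" "v = (i', k)" by fastforce
  obtain l where l: "l < c" "l \<noteq> i"
  proof (cases "i = 0")
    case True then show ?thesis using that[of 1] assms(2) by simp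
  next
    case False then show ?thesis using that[of 0] assms(2) by simp
  qed
  have "(l, 0) \<in> verts ?F" using l assms(3)[of l] by (simp add: verts_parent_forest)
  moreover have "{u, (l, 0)} \<notin> edges ?F" "{v, (l, 0)} \<notin> edges ?F"
    using uv l unfolding u by (auto simp: edge_parent_forest_iff)
  ultimately show "\<exists>w\<in>verts ?F. {u, w} \<notin> edges ?F \<and> {v, w} \<notin> edges ?F" by blast
qed

lemma nbr_sum_parent_forest:
  assumes p: "parent_fun c m p" and ij: "i < c" "j < m i"
  shows "nbr_sum (parent_forest c m p) x (i, j) =
    (if 0 < j then x (i, p i j) else 0) + (\<Sum>k | 0 < k \<and> k < m i \<and> p i k = j. x (i, k))"
proof -
  let ?A = "if 0 < j then {(i, p i j)} else {}"
  let ?B = "Pair i ` {k. 0 < k \<and> k < m i \<and> p i k = j}"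
  have lt: "p i k < k" if "0 < k" "k < m i" for k using p ij that by (simp add: parent_fun_def)
  have "{v. v \<in> verts (parent_forest c m p) \<and> {(i, j), v} \<in> edges (parent_forest c m p)} = ?A \<union> ?B"
    using ij lt[of j] by (auto simp: edge_parent_forest_iff verts_parent_forest)
  moreover have "?A \<inter> ?B = {}"
  proof -
    have False if "0 < j" "0 < k" "k < m i" "p i k = j" "k = p i j" for k
      using lt[of k] lt[of j] that ij by linarith
    then show ?thesis by auto
  qed
  ultimately have "nbr_sum (parent_forest c m p) x (i, j) = sum x ?A + sum x ?B"
    unfolding nbr_sum_def by (simp add: sum.union_disjoint)
  moreover have "sum x ?B = (\<Sum>k | 0 < k \<and> k < m i \<and> p i k = j. x (i, k))"
    by (subst sum.reindex) (auto simp: inj_on_def)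
  ultimately show ?thesis by simp
qed

lemma adj_form_parent_forest:
  assumes p: "parent_fun c m p"
  shows "adj_form (parent_forest c m p) x = 2 * (\<Sum>i<c. \<Sum>j\<in>{1..<m i}. x (i, j) * x (i, p i j))"
proof -
  have "(\<Sum>j<m i. x (i, j) * nbr_sum (parent_forest c m p) x (i, j)) =
      2 * (\<Sum>j\<in>{1..<m i}. x (i, j) * x (i, p i j))" if i: "i < c" for i
  proof -
    let ?S = "\<Sum>j\<in>{1..<m i}. x (i, j) * x (i, p i j)"
    have up: "(\<Sum>j<m i. x (i, j) * (if 0 < j then x (i, p i j) else 0)) = ?S"
      by (rule sum.mono_neutral_cong_right) auto
    have "(\<Sum>j<m i. x (i, j) * (\<Sum>k | 0 < k \<and> k < m i \<and> p i k = j. x (i, k))) =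
        (\<Sum>j<m i. \<Sum>k\<in>{1..<m i}. if j = p i k then x (i, j) * x (i, k) else 0)"
    proof (rule sum.cong[OF refl])
      fix j
      have "(\<Sum>k | 0 < k \<and> k < m i \<and> p i k = j. x (i, k)) =
          (\<Sum>k\<in>{1..<m i}. if j = p i k then x (i, k) else 0)"
        by (subst sum.inter_filter[symmetric]) (auto intro!: sum.cong)
      then show "x (i, j) * (\<Sum>k | 0 < k \<and> k < m i \<and> p i k = j. x (i, k)) =
          (\<Sum>k\<in>{1..<m i}. if j = p i k then x (i, j) * x (i, k) else 0)"
        by (auto simp: sum_distrib_left intro!: sum.cong)
    qed
    also have "\<dots> = (\<Sum>k\<in>{1..<m i}. \<Sum>j<m i. if j = p i k then x (i, j) * x (i, k) else 0)"
      by (rule sum.swap)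
    also have "\<dots> = ?S"
    proof (rule sum.cong[OF refl])
      fix k assume "k \<in> {1..<m i}"
      then have "p i k < m i" using p i by (fastforce simp: parent_fun_def)
      then show "(\<Sum>j<m i. if j = p i k then x (i, j) * x (i, k) else 0) = x (i, k) * x (i, p i k)"
        by simp
    qed
    finally have down: "(\<Sum>j<m i. x (i, j) * (\<Sum>k | 0 < k \<and> k < m i \<and> p i k = j. x (i, k))) = ?S" .
    have "(\<Sum>j<m i. x (i, j) * nbr_sum (parent_forest c m p) x (i, j)) =
        (\<Sum>j<m i. x (i, j) * (if 0 < j then x (i, p i j) else 0)
          + x (i, j) * (\<Sum>k | 0 < k \<and> k < m i \<and> p i k = j. x (i, k)))"
      by (intro sum.cong refl) (simp add: nbr_sum_parent_forest[OF p i] distrib_left)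
    then show ?thesis using up down by (simp only: sum.distrib)
  qed
  then show ?thesis unfolding adj_form_def sum_parent_forest by (simp add: sum_distrib_left)
qed

text \<open>The Rayleigh quotient of the constant vector.\<close>

lemma co_radius_ge_card:
  assumes F: "no_dominating_edge F"
  shows "real (card (verts F)) \<le> co_radius F + 1"
proof -
  have s: "simple_graph F" and "finite (verts F)" "verts F \<noteq> {}"
    using F by (auto simp: no_dominating_edge_def simple_graph_def)
  then have n: "real (card (verts F)) > 0" by (simp add: card_gt_0_iff)
  let ?n = "real (card (verts F))"
  have "adj_form F (\<lambda>_. 1) \<ge> 0" unfolding adj_form_def nbr_sum_def by (intro sum_nonneg) simp
  moreover have "?n\<^sup>2 + adj_form F (\<lambda>_. 1) - ?n \<le> co_radius F * ?n"
    using co_radius_rayleigh(1)[OF F, of "\<lambda>_. 1"] by (simp add: co_dist_form[OF s] sq_norm_on_def)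
  ultimately have "?n * ?n \<le> (co_radius F + 1) * ?n" by (simp add: power2_eq_square algebra_simps)
  then show ?thesis using n by simp
qed

section \<open>Paths minimise among trees\<close>

text \<open>The positive eigenfunction of a path decreases from the centre to the ends. The differences of
  consecutive values in the centred order satisfy the homogeneous form of the recurrence, and they are
  nonnegative at the end of the path. A minimum principle then excludes negative ones: at a negative minimum the
  right-hand side would be too large because \<open>\<mu> > 2\<close>.\<close>

lemma centred_path_solution_antimono:
  fixes X :: "nat \<Rightarrow> real"
  assumes \<mu>: "m \<ge> 2 \<Longrightarrow> \<mu> > 2" and pos: "\<And>j. j < m \<Longrightarrow> X j > 0" and zero: "\<And>j. j \<ge> m \<Longrightarrow> X j = 0"
    and eq0: "\<mu> * X 0 = S + X 1 + X 2"
    and eq: "\<And>j. 0 < j \<Longrightarrow> j < m \<Longrightarrow> \<mu> * X j = S + X (j - 2) + X (j + 2)"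
  shows "antimono X"
proof (rule ccontr)
  assume "\<not> antimono X"
  then obtain j where j: "X (Suc j) > X j" unfolding antimono_iff_le_Suc by (metis not_le)
  define D where "D k = X k - X (Suc k)" for k
  have far: "D k \<ge> 0" if "k \<ge> m - 1" for k
    using that pos[of k] zero[of k] zero[of "Suc k"] by (cases "k < m") (auto simp: D_def)
  then have jm: "j < m - 1" using j by (auto simp: D_def not_le[symmetric])
  \<comment> \<open>The most negative difference; \<open>D l \<ge> 0\<close> for \<open>l \<ge> m - 1\<close>, hence it is a minimum over all \<open>l\<close>.\<close>
  obtain k where k: "k < m - 1" "\<And>l. l < m - 1 \<Longrightarrow> D k \<le> D l"
    using ex_min_if_finite[of "D ` {..<m - 1}"] jm
    by (metis (no_types, lifting) arg_min_if_finite(1,2) empty_iff finite_lessThan lessThan_iff linorder_not_le)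
  have neg: "D k < 0" using k(2)[OF jm] j by (simp add: D_def)
  have min: "D k \<le> D l" for l using k(2)[of l] far[of l] neg by (cases "l < m - 1") auto
  have \<mu>2: "\<mu> > 2" using \<mu> jm by simp
  have scaled: "\<mu> * D k < 2 * D k" using neg \<mu>2 by simp
  have e: "\<mu> * D k = \<mu> * X k - \<mu> * X (Suc k)" by (simp add: D_def algebra_simps)
  consider "k = 0" | "k = 1" | "k \<ge> 2" by linarith
  then show False
  proof cases
    case 1
    then have "\<mu> * D k = - D 0 + D 2"
      using e eq0 eq[of 1] k(1) by (simp add: D_def numeral_2_eq_2)
    then show False using scaled min[of 2] neg 1 by simp
  next
    case 2
    then have "\<mu> * D k = D 3"
      using e eq[of 1] eq[of 2] k(1) by (simp add: D_def numeral_eq_Suc)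
    then show False using scaled min[of 3] neg by simp
  next
    case 3
    have "Suc (k - 2) = Suc k - 2" using 3 by simp
    then have "\<mu> * D k = D (k - 2) + D (k + 2)"
      using e eq[of k] eq[of "Suc k"] k(1) 3 by (simp add: D_def)
    then show False using scaled min[of "k - 2"] min[of "k + 2"] by simp
  qed
qed

lemma parent_fun_centred: "parent_fun c m (\<lambda>i j. j - 2)"
  and parent_fun_path: "parent_fun c m (\<lambda>i j. j - 1)"
  by (auto simp: parent_fun_def)

lemma card_parent_forest: "card (verts (parent_forest c m p)) = (\<Sum>i<c. m i)"
  unfolding verts_parent_forest by simp

text \<open>The hypothesis \<open>\<mu> > 2\<close> of the minimum principle comes from the number of vertices: a component with
  at least two vertices and a second component make at least three.\<close>

lemma centred_path_forest_eigenfunction_antimono: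
  assumes c: "c \<ge> 2" and m: "\<And>i. i < c \<Longrightarrow> m i \<ge> 1"
    and y: "co_eigenfunction (centred_path_forest c m) y" "\<forall>v\<in>verts (centred_path_forest c m). y v > 0"
    and i: "i < c" and jk: "j \<le> k" "k < m i"
  shows "y (i, k) \<le> y (i, j)"
proof -
  let ?P = "centred_path_forest c m"
  let ?\<mu> = "co_radius ?P + 1"
  let ?S = "sum y (verts ?P)"
  define X where "X j = (if j < m i then y (i, j) else 0)" for j
  have nd: "no_dominating_edge ?P" using parent_fun_centred c m by (rule parent_forest_no_dominating_edge)
  have row: "?\<mu> * X j = ?S + nbr_sum ?P y (i, j)" if "j < m i" for j
    using y(1) that i unfolding co_eigenfunction_def verts_parent_forest by (simp add: X_def)
  have "antimono X"
  proof (rule centred_path_solution_antimono)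
    show "?\<mu> > 2" if 2: "m i \<ge> 2"
    proof -
      obtain l where l: "l < c" "l \<noteq> i"
      proof (cases "i = 0")
        case True then show ?thesis using that[of 1] c by simp
      next
        case False then show ?thesis using that[of 0] c by simp
      qed
      have "m i + m l = sum m {i, l}" using l by simp
      also have "\<dots> \<le> (\<Sum>i<c. m i)" using l i by (intro sum_mono2) auto
      finally have "3 \<le> card (verts ?P)" using 2 m[OF l(1)] by (simp only: card_parent_forest)
      then show ?thesis using co_radius_ge_card[OF nd] by linarith
    qed
    show "X j > 0" if "j < m i" for j using that i y(2) by (simp add: X_def verts_parent_forest)
    show "X j = 0" if "j \<ge> m i" for j using that by (simp add: X_def)
    show "?\<mu> * X 0 = ?S + X 1 + X 2"
    proof -
      have "{k. 0 < k \<and> k < m i \<and> k - 2 = 0} = {1, 2} \<inter> {..<m i}" by auto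
      then have "(\<Sum>k | 0 < k \<and> k < m i \<and> k - 2 = 0. y (i, k)) = (\<Sum>k\<in>{1, 2}. X k)"
        by (simp only:) (rule sum.mono_neutral_cong_left, auto simp: X_def)
      then show ?thesis
        using row[of 0] m[OF i] by (simp add: nbr_sum_parent_forest[OF parent_fun_centred i])
    qed
    show "?\<mu> * X j = ?S + X (j - 2) + X (j + 2)" if j: "0 < j" "j < m i" for j
    proof -
      have "{k. 0 < k \<and> k < m i \<and> k - 2 = j} = {j + 2} \<inter> {..<m i}" using j by auto
      then have "(\<Sum>k | 0 < k \<and> k < m i \<and> k - 2 = j. y (i, k)) = (\<Sum>k\<in>{j + 2}. X k)"
        by (simp only:) (rule sum.mono_neutral_cong_left, auto simp: X_def)
      then show ?thesis
        using row[of j] j by (simp add: nbr_sum_parent_forest[OF parent_fun_centred i] X_def)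
    qed
  qed
  then have "X k \<le> X j" using jk(1) by (simp add: antimono_def)
  then show ?thesis using jk by (simp add: X_def)
qed

text \<open>Put the eigenfunction \<open>y\<close> of the paths on the other forest with the same labels. Since \<open>y\<close> decreases
  along the labels and every parent has a label at most that of the parent in the path, each edge
  weight \<open>y (i, j) * y (i, p i j)\<close> is at least the weight of the corresponding edge of the path. In the
  case of equality \<open>y\<close> is an eigenfunction of both forests, so both have the same neighbour sums.\<close>

lemma centred_path_forest_minimal:
  assumes c: "c \<ge> 2" and m: "\<And>i. i < c \<Longrightarrow> m i \<ge> 1"
    and p: "parent_fun c m p" and p2: "\<And>i j. i < c \<Longrightarrow> 0 < j \<Longrightarrow> j < m i \<Longrightarrow> p i j \<le> j - 2"
  shows "co_radius (centred_path_forest c m) \<le> co_radius (parent_forest c m p)"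
    and "co_radius (parent_forest c m p) = co_radius (centred_path_forest c m) \<Longrightarrow>
      parent_forest c m p = centred_path_forest c m"
proof -
  let ?P = "centred_path_forest c m" and ?F = "parent_forest c m p"
  have P: "no_dominating_edge ?P" and F: "no_dominating_edge ?F"
    using parent_fun_centred p c m by (auto intro: parent_forest_no_dominating_edge)
  obtain y where y: "\<forall>v\<in>verts ?P. y v > 0" "co_eigenfunction ?P y"
    using positive_co_eigenfunction[OF P] by blast
  have V: "verts ?F = verts ?P" by (simp add: verts_parent_forest)
  have "adj_form ?P y \<le> adj_form ?F y"
    unfolding adj_form_parent_forest[OF p] adj_form_parent_forest[OF parent_fun_centred]
  proof (intro mult_left_mono sum_mono)
    fix i j assume ij: "i \<in> {..<c}" "j \<in> {1..<m i}"
    show "y (i, j - 2) \<le> y (i, p i j)"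
      using ij p2[of i j] by (intro centred_path_forest_eigenfunction_antimono[OF c m y(2,1)]) auto
    show "0 \<le> y (i, j)" using ij y(1) by (force simp: verts_parent_forest intro: less_imp_le)
  qed simp
  note cmp = co_radius_compare[OF F P y(2,1) _ _ this, unfolded V, OF refl refl]
  show "co_radius ?P \<le> co_radius ?F" by (rule cmp(1))
  assume eq: "co_radius ?F = co_radius ?P"
  have nbr: "nbr_sum ?F y v = nbr_sum ?P y v" if v: "v \<in> verts ?P" for v
    using cmp(2)[OF eq] y(2) v unfolding co_eigenfunction_def V eq by force
  have p_eq: "p i j = j - 2" if i: "i < c" and j: "0 < j" "j < m i" for i j
    using j
  proof (induction j rule: less_induct)
    case (less j)
    show ?case
    proof (rule ccontr)
      define k where "k = p i j"
      assume "p i j \<noteq> j - 2"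
      then have k: "k < j - 2" using p2[OF i less.prems] by (simp add: k_def)
      \<comment> \<open>For the first vertex \<open>j\<close> with a wrong parent \<open>k\<close>, the induction hypothesis gives \<open>k\<close> all
        the neighbours that it has in the path, and \<open>j\<close> is one more.\<close>
      let ?A = "{l. 0 < l \<and> l < m i \<and> p i l = k}" and ?B = "{l. 0 < l \<and> l < m i \<and> l - 2 = k}"
      have "insert j ?B \<subseteq> ?A"
        using less k by (auto simp: k_def)
      then have "sum (\<lambda>l. y (i, l)) (insert j ?B) \<le> sum (\<lambda>l. y (i, l)) ?A"
        using y(1) i by (intro sum_mono2) (auto simp: verts_parent_forest intro: less_imp_le)
      moreover have "sum (\<lambda>l. y (i, l)) (insert j ?B) = y (i, j) + sum (\<lambda>l. y (i, l)) ?B"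
        using k by (intro sum.insert) auto
      moreover have "y (i, j) > 0" using y(1) i less.prems by (simp add: verts_parent_forest)
      ultimately have gt: "sum (\<lambda>l. y (i, l)) ?A > sum (\<lambda>l. y (i, l)) ?B" by simp
      have km: "k < m i" using k less.prems by simp
      have "p i k = k - 2" if "0 < k" using less.IH[of k] that k km by simp
      then show False
        using nbr[of "(i, k)"] gt km i
        by (simp add: nbr_sum_parent_forest[OF p i km] nbr_sum_parent_forest[OF parent_fun_centred[of c m] i km]
            verts_parent_forest split: if_splits)
    qed
  qed
  have "edges (parent_forest c m r) =
      (\<lambda>(i, j). {(i, j), (i, r i j)}) ` {(i, j). i < c \<and> 0 < j \<and> j < m i}" for r
    by (auto simp: parent_forest_def)
  then have "edges ?F = edges ?P" by (auto simp: p_eq intro!: image_cong)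
  then show "?F = ?P" using V by (simp add: parent_forest_def)
qed

section \<open>Balancing the orders of two paths\<close>

text \<open>Two paths with values \<open>U 1, U 2, \<dots>\<close> and \<open>W 1, W 2, \<dots>\<close> exchange their tails: \<open>L\<close> follows \<open>W\<close> up to
  position \<open>j\<close> and continues with \<open>U j\<close>, while \<open>S\<close> follows \<open>U\<close> up to position \<open>j - 1\<close> and continues with
  \<open>W (j + 1)\<close>. The edges \<open>U (j - 1) U j\<close> and \<open>W j W (j + 1)\<close> are replaced by \<open>W j U j\<close> and
  \<open>U (j - 1) W (j + 1)\<close>, and the change of weight factors.\<close>

lemma crossing_gain:
  fixes U W :: "nat \<Rightarrow> real"
  assumes j: "1 \<le> j" "j \<le> N"
  defines "L \<equiv> \<lambda>k. if k \<le> j then W k else U (k - 1)" and "S \<equiv> \<lambda>k. if k < j then U k else W (k + 1)"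
  shows "(\<Sum>k<N + 1. L k * L (k + 1)) + (\<Sum>k<N. S k * S (k + 1)) =
    (\<Sum>k<N. U k * U (k + 1)) + (\<Sum>k<N + 1. W k * W (k + 1)) + (W j - U (j - 1)) * (U j - W (j + 1))"
  using j(2)
proof (induction N rule: dec_induct)
  case base
  obtain i where i: "j = Suc i" using j(1) by (cases j) auto
  have "(\<Sum>k<j. L k * L (k + 1)) = (\<Sum>k<j. W k * W (k + 1))"
    by (intro sum.cong) (auto simp: L_def)
  moreover have "(\<Sum>k<i. S k * S (k + 1)) = (\<Sum>k<i. U k * U (k + 1))"
    by (intro sum.cong) (auto simp: S_def i)
  ultimately show ?case by (simp add: i) (simp add: L_def S_def i algebra_simps)
next
  case (step n)
  then show ?case using j(1) by (simp add: L_def S_def)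
qed

lemma crossing_sum:
  fixes U W :: "nat \<Rightarrow> real" and g :: "real \<Rightarrow> real"
  assumes j: "j \<le> N"
  defines "L \<equiv> \<lambda>k. if k \<le> j then W k else U (k - 1)" and "S \<equiv> \<lambda>k. if k < j then U k else W (k + 1)"
  shows "(\<Sum>k<N + 1. g (L k)) + (\<Sum>k<N. g (S k)) = (\<Sum>k<N. g (U k)) + (\<Sum>k<N + 1. g (W k))"
  using j
proof (induction N rule: dec_induct)
  case base
  have "(\<Sum>k<j. g (L k)) = (\<Sum>k<j. g (W k))" "(\<Sum>k<j. g (S k)) = (\<Sum>k<j. g (U k))"
    by (intro sum.cong; simp add: L_def S_def)+
  then show ?case by (simp add: L_def)
next
  case (step n)
  then show ?case by (simp add: L_def S_def)
qed

text \<open>The difference \<open>W j - U (j - 1)\<close> is positive at \<open>j = 1\<close> and not positive at \<open>j = B + 1\<close>. Where it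
  changes sign, both factors in the gain of the exchange are nonnegative.\<close>

lemma crossing_exists:
  fixes U W :: "nat \<Rightarrow> real"
  assumes "U 0 = 0" "W 1 > 0" "W (B + 1) \<le> U B" "1 \<le> B"
  shows "\<exists>j. 1 \<le> j \<and> j \<le> B \<and> W j > U (j - 1) \<and> W (j + 1) \<le> U j"
proof -
  define j where "j = (LEAST k. 1 \<le> k \<and> W (k + 1) \<le> U k)"
  have j: "1 \<le> j \<and> W (j + 1) \<le> U j"
    unfolding j_def by (rule LeastI[of _ B]) (use assms in auto)
  have "j \<le> B" unfolding j_def by (rule Least_le) (use assms in auto)
  moreover have "W j > U (j - 1)"
  proof (cases "j = 1")
    case False
    then have "\<not> (1 \<le> j - 1 \<and> W (j - 1 + 1) \<le> U (j - 1))"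
      unfolding j_def by (intro not_less_Least) (use j in \<open>simp add: j_def\<close>)
    then show ?thesis using False j by auto
  qed (use assms in simp)
  ultimately show ?thesis using j by blast
qed

text \<open>Positions are counted from \<open>1\<close> and the values beyond both ends are \<open>0\<close>. Then end vertices obey
  the same equations as inner ones, and sums along a path may run over any sufficiently long range.\<close>

definition padded :: "(nat \<Rightarrow> nat) \<Rightarrow> (nat \<times> nat \<Rightarrow> real) \<Rightarrow> nat \<Rightarrow> nat \<Rightarrow> real" where
  "padded m x i k = (if 1 \<le> k \<and> k \<le> m i then x (i, k - 1) else 0)"

lemma sum_padded:
  assumes "g 0 = 0" "m i < N"
  shows "(\<Sum>j<m i. g (x (i, j))) = (\<Sum>k<N. g (padded m x i k))"
proof -
  have "(\<Sum>j<m i. g (x (i, j))) = (\<Sum>k\<in>{1..m i}. g (x (i, k - 1)))"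
    by (rule sum.reindex_bij_witness[of _ "\<lambda>k. k - 1" Suc]) auto
  also have "\<dots> = (\<Sum>k<N. g (padded m x i k))"
    by (rule sum.mono_neutral_cong_left) (use assms in \<open>auto simp: padded_def\<close>)
  finally show ?thesis .
qed

lemma sum_edges_padded:
  assumes "m i \<le> N"
  shows "(\<Sum>j\<in>{1..<m i}. x (i, j) * x (i, j - 1)) = (\<Sum>k<N. padded m x i k * padded m x i (k + 1))"
proof -
  have "(\<Sum>j\<in>{1..<m i}. x (i, j) * x (i, j - 1)) = (\<Sum>k\<in>{1..<m i}. padded m x i k * padded m x i (k + 1))"
    by (rule sum.cong) (auto simp: padded_def)
  also have "\<dots> = (\<Sum>k<N. padded m x i k * padded m x i (k + 1))"
    by (rule sum.mono_neutral_left) (use assms in \<open>auto simp: padded_def\<close>)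
  finally show ?thesis .
qed

lemma path_forest_eigen_equation:
  assumes y: "co_eigenfunction (path_forest c m) y" and i: "i < c" and j: "j < m i"
  shows "sum y (verts (path_forest c m)) + padded m y i j + padded m y i (j + 2)
    = (co_radius (path_forest c m) + 1) * padded m y i (j + 1)"
proof -
  have "{k. 0 < k \<and> k < m i \<and> k - 1 = j} = {j + 1} \<inter> {..<m i}" by auto
  then have "(\<Sum>k | 0 < k \<and> k < m i \<and> k - 1 = j. y (i, k)) = padded m y i (j + 2)"
    by (auto simp: padded_def)
  then have "nbr_sum (path_forest c m) y (i, j) = padded m y i j + padded m y i (j + 2)"
    unfolding nbr_sum_parent_forest[OF parent_fun_path[of c m] i j]
    using j by (auto simp: padded_def)
  then show ?thesis
    using y i j unfolding co_eigenfunction_def by (force simp: verts_parent_forest padded_def)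
qed

lemma sum_split_two:
  fixes g :: "nat \<Rightarrow> 'b::comm_monoid_add"
  assumes "a < c" "b < c" "a \<noteq> b"
  shows "(\<Sum>i<c. g i) = (g a + g b) + (\<Sum>i\<in>{..<c} - {a, b}. g i)"
proof -
  have "(\<Sum>i<c. g i) = g a + (\<Sum>i\<in>{..<c} - {a}. g i)"
    using assms by (intro sum.remove) auto
  also have "(\<Sum>i\<in>{..<c} - {a}. g i) = g b + (\<Sum>i\<in>{..<c} - {a} - {b}. g i)"
    using assms by (intro sum.remove) auto
  also have "{..<c} - {a} - {b} = {..<c} - {a, b}" by auto
  finally show ?thesis by (simp add: add.assoc)
qed

text \<open>The positive eigenfunction \<open>y\<close> of the more balanced forest has values \<open>U\<close> and \<open>W\<close> on the two paths that
  differ. Exchanging their tails at a sign change rearranges these values on paths with one vertex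
  more and one vertex less, without losing weight. If the radii were equal, the
  eigenvalue equations of both forests at the vertex that carries \<open>U j\<close> would hold. Its neighbours carry
  \<open>W j\<close> and \<open>U (j + 1)\<close> in one forest and \<open>U (j - 1)\<close> and \<open>U (j + 1)\<close> in the other, which is a contradiction
  because \<open>W j > U (j - 1)\<close>.\<close>

lemma balancing_step:
  assumes c: "c \<ge> 2" and m: "\<And>i. i < c \<Longrightarrow> m i \<ge> 1"
    and a: "a < c" and b: "b < c" and ab: "m a \<ge> m b + 2"
  defines "m' \<equiv> m(a := m a - 1, b := m b + 1)"
  shows "co_radius (path_forest c m') < co_radius (path_forest c m)"
proof -
  let ?P = "path_forest c m'" and ?F = "path_forest c m"
  have ne: "a \<noteq> b" using ab by auto
  have m': "m' i \<ge> 1" if "i < c" for i using m[OF that] ab by (auto simp: m'_def)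
  have P: "no_dominating_edge ?P" and F: "no_dominating_edge ?F"
    using parent_fun_path c m m' by (auto intro: parent_forest_no_dominating_edge)
  obtain y where y: "\<forall>v\<in>verts ?P. y v > 0" "co_eigenfunction ?P y"
    using positive_co_eigenfunction[OF P] by blast
  define U where "U = padded m' y a"
  define W where "W = padded m' y b"
  define A where "A = m a - 1"
  define B where "B = m b + 1"
  have size: "m' a = A" "m' b = B" "m a = A + 1" "m b = B - 1" "B \<le> A" "1 \<le> B"
    using ab ne by (auto simp: m'_def A_def B_def)
  have ypos: "y (i, j) > 0" if "i < c" "j < m' i" for i j
    using y(1) that by (simp add: verts_parent_forest)
  have "\<exists>j. 1 \<le> j \<and> j \<le> B \<and> W j > U (j - 1) \<and> W (j + 1) \<le> U j"
  proof (rule crossing_exists)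
    show "U 0 = 0" by (simp add: U_def padded_def)
    show "W 1 > 0" using ypos[OF b, of 0] size by (simp add: W_def padded_def)
    have "B - 1 < m' a" using size by linarith
    then have "0 \<le> y (a, B - 1)" by (intro less_imp_le ypos[OF a])
    then show "W (B + 1) \<le> U B"
      using size by (simp add: W_def U_def padded_def)
  qed (use size in simp)
  then obtain j where j: "1 \<le> j" "j \<le> B" "W j > U (j - 1)" "W (j + 1) \<le> U j" by blast
  define L where "L k = (if k \<le> j then W k else U (k - 1))" for k
  define S where "S k = (if k < j then U k else W (k + 1))" for k
  define z where "z v = (if fst v = a then L (snd v + 1) else if fst v = b then S (snd v + 1) else y v)" for v
  have za: "padded m z a = L"
  proof
    fix k show "padded m z a k = L k"
      using j size ne by (auto simp: padded_def z_def L_def U_def W_def)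
  qed
  have zb: "padded m z b = S"
  proof
    fix k show "padded m z b k = S k"
      using j size ne by (auto simp: padded_def z_def S_def U_def W_def)
  qed
  have other: "m' i = m i" "z (i, k) = y (i, k)" if "i \<in> {..<c} - {a, b}" for i k
    using that by (auto simp: m'_def z_def)
  have sums: "(\<Sum>v\<in>verts ?F. g (z v)) = (\<Sum>v\<in>verts ?P. g (y v))" if g: "g 0 = 0" for g :: "real \<Rightarrow> real"
  proof -
    let ?N = "A + 2"
    have "(\<Sum>j<m a. g (z (a, j))) + (\<Sum>j<m b. g (z (b, j))) = (\<Sum>k<?N + 1. g (L k)) + (\<Sum>k<?N. g (S k))"
      unfolding za[symmetric] zb[symmetric] using g size
      by (intro arg_cong2[of _ _ _ _ "(+)"] sum_padded) auto
    also have "\<dots> = (\<Sum>k<?N. g (U k)) + (\<Sum>k<?N + 1. g (W k))"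
      unfolding L_def S_def using j size by (intro crossing_sum) simp
    also have "\<dots> = (\<Sum>j<m' a. g (y (a, j))) + (\<Sum>j<m' b. g (y (b, j)))"
      unfolding U_def W_def using g size
      by (intro arg_cong2[of _ _ _ _ "(+)"] sum_padded[symmetric]) auto
    finally show ?thesis
      unfolding sum_parent_forest sum_split_two[OF a b ne] by (simp add: other)
  qed
  have s: "sum z (verts ?F) = sum y (verts ?P)" using sums[of "\<lambda>t. t"] by simp
  have n: "sq_norm_on (verts ?F) z = sq_norm_on (verts ?P) y"
    using sums[of "\<lambda>t. t\<^sup>2"] by (simp add: sq_norm_on_def)
  have adj: "adj_form ?P y \<le> adj_form ?F z"
  proof -
    let ?N = "A + 2"
    let ?e = "\<lambda>x i k. x (i, k) * x (i, k - 1) :: real"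
    have "(\<Sum>k\<in>{1..<m a}. ?e z a k) + (\<Sum>k\<in>{1..<m b}. ?e z b k) =
        (\<Sum>k<?N + 1. L k * L (k + 1)) + (\<Sum>k<?N. S k * S (k + 1))"
      unfolding za[symmetric] zb[symmetric] using size
      by (intro arg_cong2[of _ _ _ _ "(+)"] sum_edges_padded) auto
    also have "\<dots> = (\<Sum>k<?N. U k * U (k + 1)) + (\<Sum>k<?N + 1. W k * W (k + 1))
        + (W j - U (j - 1)) * (U j - W (j + 1))"
      unfolding L_def S_def using j size by (intro crossing_gain) auto
    also have "\<dots> \<ge> (\<Sum>k<?N. U k * U (k + 1)) + (\<Sum>k<?N + 1. W k * W (k + 1))"
      using j by simp
    also have "(\<Sum>k<?N. U k * U (k + 1)) + (\<Sum>k<?N + 1. W k * W (k + 1)) =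
        (\<Sum>k\<in>{1..<m' a}. ?e y a k) + (\<Sum>k\<in>{1..<m' b}. ?e y b k)"
      unfolding U_def W_def using size
      by (intro arg_cong2[of _ _ _ _ "(+)"] sum_edges_padded[symmetric]) auto
    finally have "(\<Sum>k\<in>{1..<m' a}. ?e y a k) + (\<Sum>k\<in>{1..<m' b}. ?e y b k)
        \<le> (\<Sum>k\<in>{1..<m a}. ?e z a k) + (\<Sum>k\<in>{1..<m b}. ?e z b k)" .
    then show ?thesis
      unfolding adj_form_parent_forest[OF parent_fun_path] sum_split_two[OF a b ne]
      by (simp add: other)
  qed
  note cmp = co_radius_compare[OF F P y(2,1) s n adj]
  have "co_radius ?F \<noteq> co_radius ?P"
  proof
    assume eq: "co_radius ?F = co_radius ?P"
    have "sum z (verts ?F) + L j + L (j + 2) = (co_radius ?F + 1) * L (j + 1)"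
      using path_forest_eigen_equation[OF cmp(2)[OF eq] a, of j] j size unfolding za by simp
    moreover have "sum y (verts ?P) + U (j - 1) + U (j + 1) = (co_radius ?P + 1) * U j"
      using path_forest_eigen_equation[OF y(2) a, of "j - 1"] j size unfolding U_def[symmetric] by simp
    ultimately have "W j = U (j - 1)" unfolding eq s by (simp add: L_def)
    then show False using j by simp
  qed
  then show ?thesis using cmp(1) by simp
qed

definition balanced :: "nat \<Rightarrow> (nat \<Rightarrow> nat) \<Rightarrow> bool" where
  "balanced c m \<longleftrightarrow> (\<forall>i<c. \<forall>k<c. m i \<le> m k + 1)"

text \<open>Each balancing step lowers the sum of the squares of the orders, so repeating it ends at balanced
  orders, and the radius has strictly decreased if there was any step.\<close>

lemma balanced_path_forest_minimal:
  assumes c: "c \<ge> 2" and m: "\<And>i. i < c \<Longrightarrow> m i \<ge> 1"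
  shows "\<exists>m'. (\<forall>i<c. m' i \<ge> 1) \<and> (\<Sum>i<c. m' i) = (\<Sum>i<c. m i) \<and> balanced c m' \<and>
    (m' = m \<or> co_radius (path_forest c m') < co_radius (path_forest c m))"
  using m
proof (induction "\<Sum>i<c. (m i)\<^sup>2" arbitrary: m rule: less_induct)
  case less
  show ?case
  proof (cases "balanced c m")
    case True
    then show ?thesis using less.prems by blast
  next
    case False
    then obtain a b where ab: "a < c" "b < c" "m a \<ge> m b + 2"
      unfolding balanced_def by (auto simp: not_le)
    then have ne: "a \<noteq> b" by auto
    define m' where "m' = m(a := m a - 1, b := m b + 1)"
    have m'1: "m' i \<ge> 1" if "i < c" for i using less.prems[OF that] ab by (auto simp: m'_def)
    have rest: "(\<Sum>i\<in>{..<c} - {a, b}. g (m' i)) = (\<Sum>i\<in>{..<c} - {a, b}. g (m i))" for g :: "nat \<Rightarrow> nat"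
      by (rule sum.cong) (auto simp: m'_def)
    have eqs: "m' a = m a - 1" "m' b = m b + 1" using ne by (auto simp: m'_def)
    have total: "(\<Sum>i<c. m' i) = (\<Sum>i<c. m i)"
      using rest[of "\<lambda>t. t"] ab by (simp add: sum_split_two[OF ab(1,2) ne] eqs)
    have squares: "(\<Sum>i<c. (m' i)\<^sup>2) < (\<Sum>i<c. (m i)\<^sup>2)"
    proof -
      obtain d where d: "m a = m b + 2 + d" using ab(3) le_Suc_ex by blast
      have "(m' a)\<^sup>2 + (m' b)\<^sup>2 < (m a)\<^sup>2 + (m b)\<^sup>2"
        unfolding eqs d by (simp add: power2_eq_square algebra_simps)
      then show ?thesis using rest[of "\<lambda>t. t\<^sup>2"] by (simp add: sum_split_two[OF ab(1,2) ne])
    qed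
    have smaller: "co_radius (path_forest c m') < co_radius (path_forest c m)"
      unfolding m'_def using balancing_step[OF c less.prems ab] .
    obtain m'' where m'': "\<forall>i<c. m'' i \<ge> 1" "(\<Sum>i<c. m'' i) = (\<Sum>i<c. m' i)" "balanced c m''"
      "m'' = m' \<or> co_radius (path_forest c m'') < co_radius (path_forest c m')"
      using less.hyps[OF squares m'1] by blast
    then have "co_radius (path_forest c m'') < co_radius (path_forest c m)"
      using smaller by auto
    then show ?thesis using m'' total by (intro exI[of _ m'']) simp
  qed
qed

section \<open>The two labellings of a path\<close>

text \<open>The position, counted from one end of a path on \<open>m\<close> vertices, of the vertex with label \<open>j\<close> in the
  centred labelling.\<close>

definition centred_position :: "nat \<Rightarrow> nat \<Rightarrow> nat" where
  "centred_position m j = (if even j then m div 2 + j div 2 else m div 2 - Suc (j div 2))"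

lemma centred_position_even: "centred_position m (2 * a) = m div 2 + a"
  and centred_position_odd: "centred_position m (2 * a + 1) = m div 2 - Suc a"
  by (simp_all add: centred_position_def)

lemma centred_position_consecutive:
  assumes "j < m" "k < m"
  shows "centred_position m j = Suc (centred_position m k) \<or> centred_position m k = Suc (centred_position m j)
    \<longleftrightarrow> 0 < j \<and> k = j - 2 \<or> 0 < k \<and> j = k - 2"
proof -
  define q where "q = m div 2"
  \<comment> \<open>The bound keeps the truncated subtraction at odd labels exact.\<close>
  have odd_bound: "a < q" if "2 * a + 1 < m" for a using that unfolding q_def by linarith
  have even: "q + a = Suc (q - Suc b) \<or> q - Suc b = Suc (q + a)
      \<longleftrightarrow> 0 < 2 * a \<and> 2 * b + 1 = 2 * a - 2 \<or> 0 < 2 * b + 1 \<and> 2 * a = 2 * b + 1 - 2"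
    if "b < q" for a b :: nat
  proof -
    obtain r where "q = r + Suc b" using \<open>b < q\<close> by (metis Suc_leI le_Suc_ex add.commute)
    then have e1: "q + a = Suc (q - Suc b) \<or> q - Suc b = Suc (q + a) \<longleftrightarrow> a = 0 \<and> b = 0" by auto
    have e2: "\<not> (0 < 2 * a \<and> 2 * b + 1 = 2 * a - 2)" by presburger
    have e3: "0 < 2 * b + 1 \<and> 2 * a = 2 * b + 1 - 2 \<longleftrightarrow> a = 0 \<and> b = 0" by presburger
    show ?thesis by (simp only: e1 e2 e3 simp_thms)
  qed
  obtain a where "j = 2 * a \<or> j = 2 * a + 1" by (metis oddE evenE)
  moreover obtain b where "k = 2 * b \<or> k = 2 * b + 1" by (metis oddE evenE)
  ultimately consider "j = 2 * a" "k = 2 * b" | "j = 2 * a" "k = 2 * b + 1"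
    | "j = 2 * a + 1" "k = 2 * b" | "j = 2 * a + 1" "k = 2 * b + 1" by blast
  then show ?thesis
  proof cases
    case 1
    have "0 < 2 * x \<and> 2 * y = 2 * x - 2 \<longleftrightarrow> x = Suc y" for x y :: nat by presburger
    then show ?thesis unfolding 1 centred_position_even by auto
  next
    case 2
    then show ?thesis
      unfolding 2 centred_position_even centred_position_odd q_def[symmetric]
      using assms 2 by (intro even odd_bound) simp
  next
    case 3
    have "a < q" using assms 3 by (intro odd_bound) simp
    from even[OF this, of b] show ?thesis
      unfolding 3 centred_position_even centred_position_odd q_def[symmetric]
      by (simp only: disj_commute)
  next
    case 4
    have "a < q" "b < q" using assms 4 odd_bound by auto
    then have e1: "q - Suc a = Suc (q - Suc b) \<longleftrightarrow> b = Suc a"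
      and e2: "q - Suc b = Suc (q - Suc a) \<longleftrightarrow> a = Suc b"
      by auto
    have e3: "0 < 2 * x + 1 \<and> 2 * y + 1 = 2 * x + 1 - 2 \<longleftrightarrow> x = Suc y" for x y :: nat
      by presburger
    show ?thesis
      unfolding 4 centred_position_odd q_def[symmetric] e1 e2 e3 by (simp only: disj_commute)
  qed
qed

lemma bij_centred_position: "bij_betw (centred_position m) {..<m} {..<m}"
proof -
  define q where "q = m div 2"
  have odd_bound: "a < q" if "2 * a + 1 < m" for a using that unfolding q_def by linarith
  have inj: "inj_on (centred_position m) {..<m}"
  proof (rule inj_onI)
    fix j k assume jk: "j \<in> {..<m}" "k \<in> {..<m}" "centred_position m j = centred_position m k"
    obtain a where "j = 2 * a \<or> j = 2 * a + 1" by (metis oddE evenE)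
    moreover obtain b where "k = 2 * b \<or> k = 2 * b + 1" by (metis oddE evenE)
    ultimately consider "j = 2 * a" "k = 2 * b" | "j = 2 * a" "k = 2 * b + 1"
      | "j = 2 * a + 1" "k = 2 * b" | "j = 2 * a + 1" "k = 2 * b + 1" by blast
    then show "j = k"
    proof cases
      case 1
      then show ?thesis using jk(3) by (simp add: centred_position_even)
    next
      case 2
      then have "b < q" "q + a = q - Suc b"
        using jk odd_bound by (auto simp only: centred_position_even centred_position_odd q_def lessThan_iff)
      then show ?thesis by linarith
    next
      case 3
      then have "a < q" "q - Suc a = q + b"
        using jk odd_bound by (auto simp only: centred_position_even centred_position_odd q_def lessThan_iff)
      then show ?thesis by linarith
    next
      case 4
      then have "a < q" "b < q" "q - Suc a = q - Suc b"
        using jk odd_bound by (auto simp only: centred_position_even centred_position_odd q_def lessThan_iff)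
      then show ?thesis using 4 by linarith
    qed
  qed
  have "centred_position m j < m" if "j < m" for j
  proof (cases "even j")
    case True
    then obtain a where a: "j = 2 * a" by (elim evenE)
    show ?thesis using that unfolding a centred_position_even by linarith
  next
    case False
    then show ?thesis using that by (simp add: centred_position_def)
  qed
  then have "centred_position m ` {..<m} \<subseteq> {..<m}" by auto
  then show ?thesis using inj by (simp add: bij_betw_def endo_inj_surj)
qed

lemma centred_path_forest_iso: "centred_path_forest c m \<cong>\<^sub>G path_forest c m"
proof -
  let ?f = "\<lambda>(i, j). (i, centred_position (m i) j)"
  let ?V = "SIGMA i:{..<c}. {..<m i}"
  have bij: "bij_betw ?f ?V ?V"
  proof -
    have pos_inj: "j = k"
      if "j < m i" "k < m i" "centred_position (m i) j = centred_position (m i) k" for i j k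
      using bij_betw_imp_inj_on[OF bij_centred_position[of "m i"]] that by (simp add: inj_on_def)
    have inj: "inj_on ?f ?V"
      by (rule inj_onI) (auto intro: pos_inj)
    moreover have "?f ` ?V \<subseteq> ?V"
      using bij_betw_apply[OF bij_centred_position] by auto
    ultimately show ?thesis by (simp add: bij_betw_def endo_inj_surj)
  qed
  have edge: "{(i, j), (i', k)} \<in> edges (centred_path_forest c m) \<longleftrightarrow>
      {?f (i, j), ?f (i', k)} \<in> edges (path_forest c m)"
    if "i < c" "j < m i" "i' < c" "k < m i'" for i j i' k
  proof (cases "i' = i")
    case True
    have lt: "centred_position (m i) j < m i" "centred_position (m i) k < m i"
      using that True bij_betw_apply[OF bij_centred_position[of "m i"]] by auto
    have "{?f (i, j), ?f (i, k)} \<in> edges (path_forest c m) \<longleftrightarrow>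
        centred_position (m i) j = Suc (centred_position (m i) k) \<or>
        centred_position (m i) k = Suc (centred_position (m i) j)"
      using lt that by (auto simp: edge_parent_forest_iff)
    also have "\<dots> \<longleftrightarrow> 0 < j \<and> k = j - 2 \<or> 0 < k \<and> j = k - 2"
      using that True by (intro centred_position_consecutive) auto
    also have "\<dots> \<longleftrightarrow> {(i, j), (i, k)} \<in> edges (centred_path_forest c m)"
      using that True by (auto simp: edge_parent_forest_iff)
    finally show ?thesis unfolding True by (rule sym)
  next
    case False
    then show ?thesis by (simp add: edge_parent_forest_iff)
  qed
  show ?thesis
    unfolding graph_iso_def verts_parent_forest
    using bij edge by (intro exI[of _ ?f]) auto
qed

section \<open>Peeling a forest leaf by leaf\<close>

text \<open>Connectivity of the subgraph induced on \<open>S\<close>, expressed by cuts instead of paths: removing a leaf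
  is then a matter of moving it to the right side of the cut.\<close>

definition cut_connected :: "'a sgraph \<Rightarrow> 'a set \<Rightarrow> bool" where
  "cut_connected F S \<longleftrightarrow>
     (\<forall>X. X \<subseteq> S \<longrightarrow> X \<noteq> {} \<longrightarrow> X \<noteq> S \<longrightarrow> (\<exists>u\<in>X. \<exists>v\<in>S - X. {u, v} \<in> edges F))"

lemma is_path_Cons:
  assumes "p \<noteq> []"
  shows "is_path F (x # p) \<longleftrightarrow> x \<in> verts F \<and> x \<notin> set p \<and> {x, hd p} \<in> edges F \<and> is_path F p"
proof -
  have "(\<forall>i. Suc i < length (x # p) \<longrightarrow> {(x # p) ! i, (x # p) ! Suc i} \<in> edges F) \<longleftrightarrow>
      {x, hd p} \<in> edges F \<and> (\<forall>i. Suc i < length p \<longrightarrow> {p ! i, p ! Suc i} \<in> edges F)" (is "?L \<longleftrightarrow> ?R")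
  proof
    assume L: ?L
    have "{x, hd p} \<in> edges F" using spec[OF L, of 0] assms by (simp add: hd_conv_nth)
    moreover have "{p ! i, p ! Suc i} \<in> edges F" if "Suc i < length p" for i
      using spec[OF L, of "Suc i"] that by simp
    ultimately show ?R by blast
  next
    assume R: ?R
    show ?L
    proof (intro allI impI)
      fix i assume "Suc i < length (x # p)"
      then show "{(x # p) ! i, (x # p) ! Suc i} \<in> edges F"
        using R assms by (cases i) (auto simp: hd_conv_nth)
    qed
  qed
  then show ?thesis using assms unfolding is_path_def by auto
qed

lemma is_path_take:
  assumes "is_path F p" "0 < n"
  shows "is_path F (take n p)"
  using assms set_take_subset[of n p] unfolding is_path_def by auto

text \<open>Take a longest path in \<open>S\<close> that ends in \<open>b\<close>. Every neighbour of its first vertex \<open>a\<close> lies on the path,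
  and a neighbour other than the second vertex would close a cycle.\<close>

lemma leaf_avoiding:
  assumes F: "forest F" and S: "S \<subseteq> verts F" and con: "cut_connected F S" and b: "b \<in> S" and two: "S \<noteq> {b}"
  shows "\<exists>a\<in>S. \<exists>q\<in>S. a \<noteq> b \<and> a \<noteq> q \<and> (\<forall>v\<in>S. {a, v} \<in> edges F \<longleftrightarrow> v = q)"
proof -
  have simple: "simple_graph F" using F by (simp add: forest_def)
  have fin: "finite S" using simple S by (auto simp: simple_graph_def intro: finite_subset)
  define P where "P p \<longleftrightarrow> is_path F p \<and> set p \<subseteq> S \<and> last p = b" for p
  obtain v where v: "v \<in> S" "v \<noteq> b" "{b, v} \<in> edges F"
    using con b two unfolding cut_connected_def by (elim allE[of _ "{b}"]) auto
  have start: "P [v, b]"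
    using v b S by (auto simp: P_def is_path_def less_Suc_eq insert_commute)
  have "\<forall>p. P p \<longrightarrow> length p < Suc (card S)"
  proof (intro allI impI)
    fix p assume "P p"
    then have "length p = card (set p)" "set p \<subseteq> S" by (auto simp: P_def is_path_def distinct_card)
    then show "length p < Suc (card S)" using card_mono[OF fin] by (simp add: less_Suc_eq_le)
  qed
  then obtain p where p: "P p" and longest: "\<And>p'. P p' \<Longrightarrow> length p' \<le> length p"
    using ex_has_greatest_nat[of P "[v, b]" length "Suc (card S)"] start by blast
  have "2 \<le> length p" using longest[OF start] by simp
  then obtain a q r where p_eq: "p = a # q # r"
    by (metis One_nat_def Suc_1 Suc_le_length_iff)
  have pa: "a \<in> S" "q \<in> S" "a \<noteq> q" "{a, q} \<in> edges F" "a \<notin> set (q # r)" "last (q # r) = b"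
    using p is_path_Cons[of "q # r" F a] unfolding P_def p_eq by auto
  have ab: "a \<noteq> b" using pa(5,6) by (metis last_in_set list.distinct(1))
  have only: "x = q" if x: "x \<in> S" "{a, x} \<in> edges F" for x
  proof (rule ccontr)
    assume ne: "x \<noteq> q"
    have xa: "x \<noteq> a" using simple_graph_edgeD[OF simple x(2)] by blast
    have "x \<in> set p"
    proof (rule ccontr)
      assume "x \<notin> set p"
      then have "P (x # p)"
        using p x S is_path_Cons[of p F x] unfolding P_def p_eq by (auto simp: insert_commute)
      then show False using longest by fastforce
    qed
    then obtain i where i: "i < length p" "p ! i = x" by (metis in_set_conv_nth)
    have "i \<noteq> 0" using i(2) xa by (intro notI) (simp add: p_eq)
    moreover have "i \<noteq> 1" using i(2) ne by (intro notI) (simp add: p_eq)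
    ultimately have i2: "2 \<le> i" by simp
    have "is_cycle F (take (Suc i) p)"
      unfolding is_cycle_def
    proof (intro conjI)
      show "is_path F (take (Suc i) p)" using p by (intro is_path_take) (auto simp: P_def)
      show "3 \<le> length (take (Suc i) p)" using i i2 by simp
      have "last (take (Suc i) p) = x" using i by (simp add: take_Suc_conv_app_nth)
      moreover have "hd (take (Suc i) p) = a" by (simp add: p_eq)
      ultimately show "{last (take (Suc i) p), hd (take (Suc i) p)} \<in> edges F"
        using x(2) by (simp add: insert_commute)
    qed
    then show False using F unfolding forest_def by blast
  qed
  have "\<forall>v\<in>S. {a, v} \<in> edges F \<longleftrightarrow> v = q" using only pa(4) by blast
  then show ?thesis using ab pa(1-3) by blast
qed

lemma cut_connected_remove_leaf:
  assumes con: "cut_connected F S" and q: "q \<in> S" "a \<noteq> q" and leaf: "\<And>v. v \<in> S \<Longrightarrow> {a, v} \<in> edges F \<longleftrightarrow> v = q"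
    and a: "a \<in> S"
  shows "cut_connected F (S - {a})"
  unfolding cut_connected_def
proof (intro allI impI)
  fix X assume X: "X \<subseteq> S - {a}" "X \<noteq> {}" "X \<noteq> S - {a}"
  \<comment> \<open>Put the leaf on the same side as its neighbour, so that no edge across the cut contains it.\<close>
  define Y where "Y = (if q \<in> X then insert a X else X)"
  have "Y \<subseteq> S" "Y \<noteq> {}" "Y \<noteq> S" using X a unfolding Y_def by auto
  then obtain u v where uv: "u \<in> Y" "v \<in> S - Y" "{u, v} \<in> edges F"
    using con unfolding cut_connected_def by blast
  have "u \<noteq> a" using uv leaf[of v] X by (auto simp: Y_def split: if_splits)
  moreover have "v \<noteq> a"
    using uv leaf[of u] X by (auto simp: Y_def insert_commute split: if_splits)
  ultimately show "\<exists>u\<in>X. \<exists>v\<in>S - {a} - X. {u, v} \<in> edges F"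
    using uv by (auto simp: Y_def split: if_splits)
qed

text \<open>Each entry has exactly one neighbour among the earlier entries, and from the third
  entry on this neighbour is not the entry immediately before. For \<open>j = 1\<close> and \<open>j = 2\<close> the truncated
  subtraction leaves only the neighbour \<open>0\<close>. These are the parent functions that are
  comparable with the centred labelling of a path.\<close>

definition peeling_order :: "'a sgraph \<Rightarrow> 'a list \<Rightarrow> bool" where
  "peeling_order F xs \<longleftrightarrow> distinct xs \<and>
     (\<forall>j<length xs. 0 < j \<longrightarrow> (\<exists>k<j. k \<le> j - 2 \<and> (\<forall>l<j. {xs ! l, xs ! j} \<in> edges F \<longleftrightarrow> l = k)))"

text \<open>Remove leaves one after the other and list them in reverse. Unless \<open>q\<close> is the only vertex left, a leaf
  \<open>a\<close> with neighbour \<open>q\<close> must not be preceded by \<open>q\<close>, so the next leaf to remove has to be different from \<open>q\<close>. That is possible because a leaf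
  can avoid any prescribed vertex; the vertex \<open>b\<close> passes the prohibition on in the induction.\<close>

lemma peeling_order_exists:
  assumes "forest F" "S \<subseteq> verts F" "cut_connected F S" "S \<noteq> {}"
  shows "\<exists>xs. peeling_order F xs \<and> set xs = S \<and> (2 \<le> card S \<longrightarrow> last xs \<noteq> b)"
  using assms(2-4)
proof (induction "card S" arbitrary: S b rule: less_induct)
  case less
  have fin: "finite S"
    using assms(1) less.prems(1) by (auto simp: forest_def simple_graph_def intro: finite_subset)
  show ?case
  proof (cases "2 \<le> card S")
    case False
    moreover have "card S \<noteq> 0" using fin less.prems(3) by simp
    ultimately have "card S = 1" by linarith
    then obtain v where "S = {v}" by (auto simp: card_1_singleton_iff)
    then show ?thesis by (intro exI[of _ "[v]"]) (auto simp: peeling_order_def)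
  next
    case True
    \<comment> \<open>If \<open>b\<close> lies outside \<open>S\<close> there is nothing to avoid, and an arbitrary vertex takes its place.\<close>
    obtain b' where b': "b' \<in> S" "b \<in> S \<Longrightarrow> b' = b" using less.prems(3) by blast
    have "S \<noteq> {b'}" using True by auto
    then obtain a q where a: "a \<in> S" "q \<in> S" "a \<noteq> b'" "a \<noteq> q"
      and leaf: "\<And>v. v \<in> S \<Longrightarrow> {a, v} \<in> edges F \<longleftrightarrow> v = q"
      using leaf_avoiding[OF assms(1) less.prems(1,2) b'(1)] by blast
    have ab: "a \<noteq> b" using a b' by blast
    let ?S = "S - {a}"
    have card: "card ?S = card S - 1" using fin a by simp
    have "cut_connected F ?S"
      using cut_connected_remove_leaf[OF less.prems(2) a(2,4) leaf a(1)] .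
    moreover have "card ?S < card S" "?S \<subseteq> verts F" "?S \<noteq> {}" using card True less.prems(1) a by auto
    ultimately obtain xs where xs: "peeling_order F xs" "set xs = ?S" "2 \<le> card ?S \<longrightarrow> last xs \<noteq> q"
      using less.hyps[of ?S q] by blast
    have dist: "distinct xs" using xs(1) by (simp add: peeling_order_def)
    have len: "length xs = card S - 1" using distinct_card[OF dist] xs(2) card by simp
    obtain k where k: "k < length xs" "xs ! k = q" using a xs(2) by (metis Diff_iff in_set_conv_nth singletonD)
    have k2: "k \<le> length xs - 2"
    proof (cases "2 \<le> card ?S")
      case False
      then show ?thesis using k len card by simp
    next
      case True
      then have "last xs \<noteq> q" using xs(3) by simp
      moreover have "last xs = xs ! (length xs - 1)" using k by (intro last_conv_nth) auto
      ultimately have "k \<noteq> length xs - 1" using k by auto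
      then show ?thesis using k by linarith
    qed
    have "peeling_order F (xs @ [a])"
      unfolding peeling_order_def
    proof (intro conjI allI impI)
      show "distinct (xs @ [a])" using dist xs(2) by simp
      fix j assume j: "j < length (xs @ [a])" "0 < j"
      show "\<exists>k<j. k \<le> j - 2 \<and> (\<forall>l<j. {(xs @ [a]) ! l, (xs @ [a]) ! j} \<in> edges F \<longleftrightarrow> l = k)"
      proof (cases "j < length xs")
        case True
        then obtain k' where "k' < j" "k' \<le> j - 2" "\<forall>l<j. {xs ! l, xs ! j} \<in> edges F \<longleftrightarrow> l = k'"
          using xs(1) j(2) unfolding peeling_order_def by blast
        then show ?thesis using True by (intro exI[of _ k']) (simp add: nth_append)
      next
        case False
        then have jl: "j = length xs" using j by simp
        have "{xs ! l, a} \<in> edges F \<longleftrightarrow> l = k" if "l < length xs" for l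
        proof -
          have "xs ! l \<in> S" using that xs(2) nth_mem by blast
          then have "{xs ! l, a} \<in> edges F \<longleftrightarrow> xs ! l = q" 
            using leaf[OF \<open>xs ! l \<in> S\<close>] by (simp only: insert_commute[of "xs ! l" a])
          then show ?thesis using that k dist nth_eq_iff_index_eq by blast
        qed
        then show ?thesis using k k2 unfolding jl by (intro exI[of _ k]) (simp add: nth_append)
      qed
    qed
    then show ?thesis using xs(2) a ab by (intro exI[of _ "xs @ [a]"]) auto
  qed
qed

section \<open>Components as induced subtrees\<close>

definition edge_rel :: "'a sgraph \<Rightarrow> ('a \<times> 'a) set" where
  "edge_rel F = {(u, v). {u, v} \<in> edges F}"

definition joined :: "'a sgraph \<Rightarrow> ('a \<times> 'a) set" where
  "joined F = {(u, v). \<exists>p. path_between F u p v}"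

lemma path_imp_rtrancl:
  "is_path F p \<Longrightarrow> (hd p, last p) \<in> (edge_rel F)\<^sup>*"
proof (induction p)
  case (Cons x p)
  show ?case
  proof (cases "p = []")
    case False
    then have "{x, hd p} \<in> edges F" "is_path F p" using Cons.prems is_path_Cons by metis+
    then show ?thesis
      using Cons.IH False by (auto simp: edge_rel_def intro: converse_rtrancl_into_rtrancl)
  qed simp
qed (simp add: is_path_def)

text \<open>Paths do not repeat vertices, so when a step leads back to a vertex of the path found so far, the path
  is shortened to start there.\<close>

lemma rtrancl_imp_path:
  assumes s: "simple_graph F" and u: "u \<in> verts F" and r: "(u, v) \<in> (edge_rel F)\<^sup>*"
  shows "\<exists>p. path_between F u p v"
  using r u
proof (induction rule: converse_rtrancl_induct)
  case base
  then show ?case by (intro exI[of _ "[v]"]) (simp add: path_between_def is_path_def)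
next
  case (step x y)
  have e: "{x, y} \<in> edges F" using step.hyps(1) by (simp add: edge_rel_def)
  obtain p where p: "is_path F p" "hd p = y" "last p = v"
    using step.IH simple_graph_edgeD[OF s e] unfolding path_between_def by blast
  then have ne: "p \<noteq> []" by (simp add: is_path_def)
  show ?case
  proof (cases "x \<in> set p")
    case False
    then have "is_path F (x # p)" using p e ne step.prems by (simp add: is_path_Cons)
    then show ?thesis using p ne by (intro exI[of _ "x # p"]) (simp add: path_between_def)
  next
    case True
    then obtain i where i: "i < length p" "p ! i = x" by (metis in_set_conv_nth)
    have "is_path F (drop i p)"
      using p(1) i set_drop_subset[of i p] unfolding is_path_def by auto
    then show ?thesis
      using p i by (intro exI[of _ "drop i p"]) (simp add: path_between_def hd_drop_conv_nth)
  qed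
qed

lemma joined_eq:
  assumes "simple_graph F"
  shows "joined F = (edge_rel F)\<^sup>* \<inter> (verts F \<times> verts F)"
proof -
  have "(u, v) \<in> joined F \<longleftrightarrow> (u, v) \<in> (edge_rel F)\<^sup>* \<inter> (verts F \<times> verts F)" for u v
  proof
    assume "(u, v) \<in> joined F"
    then obtain p where p: "is_path F p" "hd p = u" "last p = v"
      by (auto simp: joined_def path_between_def)
    then have "p \<noteq> []" "set p \<subseteq> verts F" by (auto simp: is_path_def)
    then have "u \<in> verts F" "v \<in> verts F" using p hd_in_set last_in_set by blast+
    then show "(u, v) \<in> (edge_rel F)\<^sup>* \<inter> (verts F \<times> verts F)"
      using path_imp_rtrancl[OF p(1)] p by simp
  next
    assume "(u, v) \<in> (edge_rel F)\<^sup>* \<inter> (verts F \<times> verts F)"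
    then show "(u, v) \<in> joined F" using rtrancl_imp_path[OF assms] by (auto simp: joined_def)
  qed
  then show ?thesis by auto
qed

lemma equiv_joined:
  assumes "simple_graph F"
  shows "equiv (verts F) (joined F)"
proof (rule equivI)
  have "sym (edge_rel F)" by (auto simp: sym_def edge_rel_def insert_commute)
  then have "sym ((edge_rel F)\<^sup>*)" by (rule sym_rtrancl)
  then show "sym (joined F)" unfolding joined_eq[OF assms] by (auto simp: sym_def)
  show "trans (joined F)" unfolding joined_eq[OF assms] by (auto simp: trans_def)
  show "refl_on (verts F) (joined F)" unfolding joined_eq[OF assms] by (auto simp: refl_on_def)
  show "joined F \<subseteq> verts F \<times> verts F" unfolding joined_eq[OF assms] by auto
qed

lemma components_eq: "components F = verts F // joined F"
  by (simp add: components_def joined_def)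

lemma edge_same_component:
  assumes s: "simple_graph F" and C: "C \<in> components F" and e: "{u, v} \<in> edges F" and u: "u \<in> C"
  shows "v \<in> C"
proof -
  have "(u, v) \<in> joined F"
    using simple_graph_edgeD[OF s e] e unfolding joined_eq[OF s] by (auto simp: edge_rel_def)
  then show ?thesis
    using in_quotient_imp_closed[OF equiv_joined[OF s]] C u unfolding components_eq by metis
qed

text \<open>A walk between two vertices on different sides of a cut has to cross it.\<close>

lemma component_cut_connected:
  assumes s: "simple_graph F" and C: "C \<in> components F"
  shows "cut_connected F C"
  unfolding cut_connected_def
proof (intro allI impI)
  fix X assume X: "X \<subseteq> C" "X \<noteq> {}" "X \<noteq> C"
  then obtain u v where u: "u \<in> X" and v: "v \<in> C" "v \<notin> X" by blast
  have "u \<in> C" using u X by blast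
  then have "(u, v) \<in> joined F"
    using in_quotient_imp_in_rel[OF equiv_joined[OF s], of C u v] C v unfolding components_eq by simp
  then have "(u, v) \<in> (edge_rel F)\<^sup>*" unfolding joined_eq[OF s] by simp
  then have "v \<in> X \<or> (\<exists>x\<in>X. \<exists>y. y \<notin> X \<and> {x, y} \<in> edges F)"
    by (induction rule: rtrancl_induct) (use u in \<open>auto simp: edge_rel_def\<close>)
  then obtain x y where "x \<in> X" "y \<notin> X" "{x, y} \<in> edges F" using v by blast
  then show "\<exists>u\<in>X. \<exists>v\<in>C - X. {u, v} \<in> edges F"
    using edge_same_component[OF s C] X by blast
qed

text \<open>The parent functions are read off from a peeling order of every component.\<close>

lemma forest_iso_parent_forest:
  assumes F: "forest F" and c: "card (components F) = c"
  shows "\<exists>m p. parent_fun c m p \<and> (\<forall>i<c. m i \<ge> 1) \<and> (\<forall>i<c. \<forall>j<m i. 0 < j \<longrightarrow> p i j \<le> j - 2) \<and>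
    F \<cong>\<^sub>G parent_forest c m p"
proof -
  have s: "simple_graph F" using F by (simp add: forest_def)
  have eq: "equiv (verts F) (joined F)" using s by (rule equiv_joined)
  have fin: "finite (components F)"
    unfolding components_eq using s equiv_joined[OF s]
    by (intro finite_quotient) (auto simp: simple_graph_def equiv_def)
  obtain C where C: "bij_betw C {0..<c} (components F)"
    using ex_bij_betw_nat_finite[OF fin] c by blast
  have Ci: "C i \<in> components F" if "i < c" for i using bij_betw_apply[OF C, of i] that by simp
  have "\<exists>xs. peeling_order F xs \<and> set xs = D" if D: "D \<in> components F" for D
  proof -
    have "D \<subseteq> verts F" "D \<noteq> {}"
      using D eq Union_quotient[OF eq] in_quotient_imp_non_empty[OF eq] unfolding components_eq by blast+
    then show ?thesis
      using peeling_order_exists[OF F _ component_cut_connected[OF s D]] by blast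
  qed
  then have "\<exists>xs. peeling_order F xs \<and> set xs = C i" if "i < c" for i using Ci that by blast
  then obtain xs where xs: "\<And>i. i < c \<Longrightarrow> peeling_order F (xs i)" "\<And>i. i < c \<Longrightarrow> set (xs i) = C i"
    by metis
  define m where "m i = length (xs i)" for i
  have "\<exists>k<j. k \<le> j - 2 \<and> (\<forall>l<j. {xs i ! l, xs i ! j} \<in> edges F \<longleftrightarrow> l = k)"
    if "i < c" "j < m i" "0 < j" for i j
    using xs(1)[OF that(1)] that(2,3) unfolding peeling_order_def m_def by blast
  then obtain p where p: "\<And>i j. i < c \<Longrightarrow> j < m i \<Longrightarrow> 0 < j \<Longrightarrow>
      p i j < j \<and> p i j \<le> j - 2 \<and> (\<forall>l<j. {xs i ! l, xs i ! j} \<in> edges F \<longleftrightarrow> l = p i j)"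
    by metis
  let ?P = "parent_forest c m p"
  let ?f = "\<lambda>(i, j). xs i ! j"
  have inC: "xs i ! j \<in> C i" if "i < c" "j < m i" for i j
    using xs(2)[OF that(1)] that(2) nth_mem unfolding m_def by blast
  have same: "i = i'" if "i < c" "i' < c" "x \<in> C i" "x \<in> C i'" for i i' x
  proof -
    have "C i = C i'" using quotient_disj[OF eq] Ci that unfolding components_eq by blast
    then show ?thesis using C that by (auto simp: bij_betw_def inj_on_def)
  qed
  have bij: "bij_betw ?f (verts ?P) (verts F)"
    unfolding bij_betw_def
  proof
    show "inj_on ?f (verts ?P)"
    proof (rule inj_onI)
      fix v w assume v: "v \<in> verts ?P" and w: "w \<in> verts ?P" and vw: "?f v = ?f w"
      obtain i j where v': "v = (i, j)" "i < c" "j < m i" using v by (auto simp: verts_parent_forest)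
      obtain i' j' where w': "w = (i', j')" "i' < c" "j' < m i'" using w by (auto simp: verts_parent_forest)
      have e: "xs i ! j = xs i' ! j'" using vw v' w' by simp
      then have "i = i'" using same inC v' w' by metis
      moreover have "distinct (xs i)" using xs(1) v' by (simp add: peeling_order_def)
      ultimately show "v = w" using e v' w' by (simp add: nth_eq_iff_index_eq m_def)
    qed
    have "\<Union> (components F) = verts F" unfolding components_eq by (rule Union_quotient[OF eq])
    then have V: "verts F = (\<Union>i\<in>{0..<c}. C i)" using C by (auto simp: bij_betw_def)
    show "?f ` verts ?P = verts F"
    proof (intro equalityI subsetI)
      fix x assume "x \<in> ?f ` verts ?P"
      then obtain i j where "i < c" "j < m i" "x = xs i ! j" by (auto simp: verts_parent_forest)
      then show "x \<in> verts F" using inC[of i j] unfolding V by auto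
    next
      fix x assume "x \<in> verts F"
      then obtain i where i: "i < c" "x \<in> C i" unfolding V by auto
      then obtain j where j: "j < m i" "x = xs i ! j"
        using xs(2)[OF i(1)] unfolding m_def by (metis in_set_conv_nth)
      show "x \<in> ?f ` verts ?P"
        using i j by (intro image_eqI[of _ _ "(i, j)"]) (auto simp: verts_parent_forest)
    qed
  qed
  have edge: "{(i, j), (i', k)} \<in> edges ?P \<longleftrightarrow> {xs i ! j, xs i' ! k} \<in> edges F"
    if i: "i < c" and i': "i' < c" and j: "j < m i" and k: "k < m i'" for i j i' k
  proof (cases "i' = i")
    case True
    have lt: "{xs i ! l, xs i ! t} \<in> edges F \<longleftrightarrow> {(i, l), (i, t)} \<in> edges ?P" if "l < t" "t < m i" for l t
      using p[OF i, of t] p[OF i, of l] that i by (auto simp: edge_parent_forest_iff)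
    consider "j < k" | "k < j" | "j = k" by linarith
    then show ?thesis
    proof cases
      case 1
      then show ?thesis using lt[of j k] k True by simp
    next
      case 2
      then show ?thesis using lt[of k j] j True by (simp add: insert_commute)
    next
      case 3
      have "{xs i ! j, xs i ! j} \<notin> edges F" using simple_graph_edgeD(3)[OF s] by blast
      moreover have "{(i, j), (i, j)} \<notin> edges ?P" 
        unfolding edge_parent_forest_iff using p[OF i j] by auto
      ultimately show ?thesis using 3 True by simp
    qed
  next
    case False
    have "{xs i ! j, xs i' ! k} \<notin> edges F"
      using edge_same_component[OF s Ci[OF i], of "xs i ! j" "xs i' ! k"] inC[OF i j] inC[OF i' k]
        same[OF i i'] False by blast
    then show ?thesis using False by (simp add: edge_parent_forest_iff)
  qed
  have "?P \<cong>\<^sub>G F"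
    unfolding graph_iso_def using bij edge
    by (intro exI[of _ ?f]) (auto simp: verts_parent_forest)
  then have "F \<cong>\<^sub>G ?P" by (rule graph_iso_sym)
  moreover have "m i \<ge> 1" if "i < c" for i
  proof -
    have "C i \<noteq> {}" using in_quotient_imp_non_empty[OF eq] Ci[OF that] unfolding components_eq by blast
    then have "xs i \<noteq> []" using xs(2)[OF that] by auto
    then show ?thesis by (simp add: m_def Suc_le_eq)
  qed
  ultimately show ?thesis using p unfolding parent_fun_def by blast
qed

section \<open>The balanced paths\<close>

lemma edge_path_graph_iff:
  "{i, j} \<in> edges (path_graph k) \<longleftrightarrow> j = Suc i \<and> j < k \<or> i = Suc j \<and> i < k"
  by (auto simp: path_graph_def doubleton_eq_iff)

lemma pair_image_doubleton: "Pair i ` e = {(x, j), (y, l)} \<longleftrightarrow> x = i \<and> y = i \<and> e = {j, l}"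
proof
  assume L: "Pair i ` e = {(x, j), (y, l)}"
  then have "(x, j) \<in> Pair i ` e" "(y, l) \<in> Pair i ` e" by auto
  then have xy: "x = i" "y = i" by auto
  then have "Pair i ` e = Pair i ` {j, l}" using L by simp
  then show "x = i \<and> y = i \<and> e = {j, l}"
    using xy inj_image_eq_iff[of "Pair i" e "{j, l}"] by (simp add: inj_on_def)
qed auto

lemma edge_copies_iff:
  "{(x, j), (y, l)} \<in> edges (copies k H) \<longleftrightarrow> x = y \<and> x < k \<and> {j, l} \<in> edges H"
proof
  assume "{(x, j), (y, l)} \<in> edges (copies k H)"
  then obtain i e where "i < k" "e \<in> edges H" "Pair i ` e = {(x, j), (y, l)}"
    unfolding copies_def by auto
  then show "x = y \<and> x < k \<and> {j, l} \<in> edges H" using pair_image_doubleton by metis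
next
  assume "x = y \<and> x < k \<and> {j, l} \<in> edges H"
  then show "{(x, j), (y, l)} \<in> edges (copies k H)"
    unfolding copies_def by (auto intro!: bexI[of _ x] image_eqI[of _ _ "{j, l}"])
qed

lemma edge_disjoint_union_iff:
  "{Inl a, Inl b} \<in> edges (disjoint_union G H) \<longleftrightarrow> {a, b} \<in> edges G"
  "{Inr a', Inr b'} \<in> edges (disjoint_union G H) \<longleftrightarrow> {a', b'} \<in> edges H"
  "{Inl a, Inr b'} \<notin> edges (disjoint_union G H)"
  "{Inr b', Inl a} \<notin> edges (disjoint_union G H)"
proof -
  have l: "Inl ` e = {Inl a, Inl b :: 'a + 'b} \<longleftrightarrow> e = {a, b}" for e
    using inj_image_eq_iff[of "Inl :: 'a \<Rightarrow> 'a + 'b" e "{a, b}"] by simp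
  have r: "Inr ` e = {Inr a', Inr b' :: 'a + 'b} \<longleftrightarrow> e = {a', b'}" for e
    using inj_image_eq_iff[of "Inr :: 'b \<Rightarrow> 'a + 'b" e "{a', b'}"] by simp
  have no: "Inr ` e \<noteq> {Inl u, Inl v}" "Inl ` f \<noteq> {Inr u', Inr v'}"
    "Inl ` f \<noteq> {Inl u, Inr u'}" "Inr ` e \<noteq> {Inl u, Inr u'}"
    for u v :: 'a and u' v' :: 'b and e :: "'b set" and f :: "'a set"
    by blast+
  have D: "s \<in> edges (disjoint_union G H) \<longleftrightarrow>
      (\<exists>e\<in>edges G. Inl ` e = s) \<or> (\<exists>e\<in>edges H. Inr ` e = s)" for s
    by (auto simp: disjoint_union_def)
  show "{Inl a, Inl b} \<in> edges (disjoint_union G H) \<longleftrightarrow> {a, b} \<in> edges G"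
    unfolding D l using no(1) by blast
  show "{Inr a', Inr b'} \<in> edges (disjoint_union G H) \<longleftrightarrow> {a', b'} \<in> edges H"
    unfolding D r using no(2) by blast
  show 3: "{Inl a, Inr b'} \<notin> edges (disjoint_union G H)"
    unfolding D using no(3,4) by blast
  show "{Inr b', Inl a} \<notin> edges (disjoint_union G H)"
    using 3 by (simp add: insert_commute)
qed

lemma simple_path_graph: "simple_graph (path_graph k)"
  by (auto simp: simple_graph_def path_graph_def)

lemma simple_copies: "simple_graph H \<Longrightarrow> simple_graph (copies k H)"
  unfolding simple_graph_def copies_def
  by (fastforce simp: card_image inj_on_def)

lemma simple_disjoint_union: "simple_graph G \<Longrightarrow> simple_graph H \<Longrightarrow> simple_graph (disjoint_union G H)"
  unfolding simple_graph_def disjoint_union_def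
  by (fastforce simp: card_image)

text \<open>The graph whose complement is \<open>P_graph n c\<close>.\<close>

definition balanced_paths :: "nat \<Rightarrow> nat \<Rightarrow> (nat \<times> nat + nat \<times> nat) sgraph" where
  "balanced_paths n c = disjoint_union
     (copies (c + c * (n div c) - n) (path_graph (n div c)))
     (copies (n - c * (n div c)) (path_graph (nat \<lceil>real n / real c\<rceil>)))"

lemma simple_balanced_paths: "simple_graph (balanced_paths n c)"
  unfolding balanced_paths_def by (intro simple_disjoint_union simple_copies simple_path_graph)

text \<open>Let \<open>a\<close> be the least order. All orders are \<open>a\<close> or \<open>a + 1\<close>, and the order \<open>a + 1\<close> occurs fewer than
  \<open>c\<close> times, so \<open>a\<close> and the number of its occurrences come from the division of \<open>n\<close> by \<open>c\<close>. If
  the order \<open>a + 1\<close> occurs at all, then \<open>c\<close> does not divide \<open>n\<close>, and \<open>n / c\<close> rounds up to \<open>a + 1\<close>.\<close>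

lemma balanced_sizes:
  assumes c: "c \<ge> 1" and bal: "balanced c m"
  defines "n \<equiv> (\<Sum>i<c. m i)"
  shows "\<And>i. i < c \<Longrightarrow> m i = n div c \<or> m i = n div c + 1"
    and "card {i. i < c \<and> m i = n div c + 1} = n - c * (n div c)"
    and "card {i. i < c \<and> m i = n div c} = c + c * (n div c) - n"
    and "{i. i < c \<and> m i = n div c + 1} \<noteq> {} \<Longrightarrow> nat \<lceil>real n / real c\<rceil> = n div c + 1"
proof -
  define a where "a = Min (m ` {..<c})"
  have fin: "finite (m ` {..<c})" "m ` {..<c} \<noteq> {}" using c by (auto simp: lessThan_empty_iff)
  obtain i0 where i0: "i0 < c" "m i0 = a" using Min_in[OF fin] unfolding a_def by auto
  have sizes: "m i = a \<or> m i = a + 1" if "i < c" for i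
  proof -
    have "a \<le> m i" unfolding a_def using fin that by (intro Min_le) auto
    moreover have "m i \<le> a + 1" using bal that i0 unfolding balanced_def by metis
    ultimately show ?thesis by linarith
  qed
  let ?I1 = "{i. i < c \<and> m i = a + 1}" and ?I0 = "{i. i < c \<and> m i = a}"
  have "n = (\<Sum>i<c. a + (if m i = a + 1 then 1 else 0))"
    unfolding n_def using sizes by (intro sum.cong) auto
  also have "\<dots> = c * a + card ({..<c} \<inter> {i. m i = a + 1})"
    by (simp add: sum.distrib sum.If_cases)
  also have "{..<c} \<inter> {i. m i = a + 1} = ?I1" by auto
  finally have n: "n = c * a + card ?I1" .
  have "?I1 \<subseteq> {..<c} - {i0}" using i0 by auto
  then have "card ?I1 \<le> card ({..<c} - {i0})" by (intro card_mono) auto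
  then have lt: "card ?I1 < c" using i0 by simp
  have q: "n div c = a" using n lt c by simp
  have "card {..<c} = card (?I0 \<union> ?I1)" using sizes by (intro arg_cong[of _ _ card]) auto
  also have "\<dots> = card ?I0 + card ?I1" by (intro card_Un_disjoint) auto
  finally have c_eq: "c = card ?I0 + card ?I1" by simp
  show "\<And>i. i < c \<Longrightarrow> m i = n div c \<or> m i = n div c + 1" using sizes unfolding q .
  show "card {i. i < c \<and> m i = n div c + 1} = n - c * (n div c)" unfolding q using n by linarith
  show "card {i. i < c \<and> m i = n div c} = c + c * (n div c) - n" unfolding q using n c_eq by linarith
  assume "{i. i < c \<and> m i = n div c + 1} \<noteq> {}"
  then have pos: "card ?I1 > 0" unfolding q by (simp add: card_gt_0_iff)
  have "\<lceil>real n / real c\<rceil> = int a + 1"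
  proof (rule ceiling_unique)
    have "real n = real c * real a + real (card ?I1)" using n by (metis of_nat_add of_nat_mult)
    then show "of_int (int a + 1) - 1 < real n / real c" "real n / real c \<le> of_int (int a + 1)"
      using pos lt c by (auto simp: field_simps)
  qed
  then show "nat \<lceil>real n / real c\<rceil> = n div c + 1" unfolding q by simp
qed

lemma balanced_path_forest_iso:
  assumes c: "c \<ge> 1" and bal: "balanced c m"
  defines "n \<equiv> (\<Sum>i<c. m i)"
  shows "path_forest c m \<cong>\<^sub>G balanced_paths n c"
proof -
  define q where "q = n div c"
  define r where "r = nat \<lceil>real n / real c\<rceil>"
  let ?I1 = "{i. i < c \<and> m i = q + 1}" and ?I0 = "{i. i < c \<and> m i = q}"
  define c0 where "c0 = c + c * q - n"
  define c1 where "c1 = n - c * q"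
  note sizes = balanced_sizes[OF c bal, folded n_def, folded q_def r_def, folded c0_def c1_def]
  obtain h0 where h0: "bij_betw h0 ?I0 {0..<c0}"
    using ex_bij_betw_finite_nat[of ?I0] sizes(3) by auto
  obtain h1 where h1: "bij_betw h1 ?I1 {0..<c1}"
    using ex_bij_betw_finite_nat[of ?I1] sizes(2) by auto
  have r: "m i = r" if "i \<in> ?I1" for i using sizes(4) that by auto
  let ?P = "path_forest c m" and ?Q = "balanced_paths n c"
  have Q: "?Q = disjoint_union (copies c0 (path_graph q)) (copies c1 (path_graph r))"
    unfolding balanced_paths_def c0_def c1_def r_def q_def ..
  define f :: "nat \<times> nat \<Rightarrow> nat \<times> nat + nat \<times> nat"
    where "f v = (if m (fst v) = q then Inl (h0 (fst v), snd v) else Inr (h1 (fst v), snd v))" for v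
  have VQ: "verts ?Q = ({0..<c0} \<times> {0..<q}) <+> ({0..<c1} \<times> {0..<r})"
    unfolding Q by (simp add: disjoint_union_def copies_def path_graph_def)
  have h0_inj: "h0 i = h0 k \<longleftrightarrow> i = k" if "i < c" "k < c" "m i = q" "m k = q" for i k
    using inj_on_eq_iff[OF bij_betw_imp_inj_on[OF h0]] that by simp
  have h1_inj: "h1 i = h1 k \<longleftrightarrow> i = k" if "i < c" "k < c" "m i \<noteq> q" "m k \<noteq> q" for i k
    using inj_on_eq_iff[OF bij_betw_imp_inj_on[OF h1]] that sizes(1) by fastforce
  have bij: "bij_betw f (verts ?P) (verts ?Q)"
    unfolding bij_betw_def
  proof
    show "inj_on f (verts ?P)"
      by (rule inj_onI) (auto simp: f_def verts_parent_forest h0_inj h1_inj split: if_splits)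
    show "f ` verts ?P = verts ?Q"
    proof (intro equalityI subsetI)
      fix w assume "w \<in> f ` verts ?P"
      then obtain i j where ij: "i < c" "j < m i" "w = f (i, j)" by (auto simp: verts_parent_forest)
      show "w \<in> verts ?Q"
      proof (cases "m i = q")
        case True
        then have "h0 i \<in> {0..<c0}" using bij_betw_apply[OF h0] ij by simp
        then show ?thesis using ij True unfolding VQ by (simp add: f_def InlI)
      next
        case False
        then have i1: "i \<in> ?I1" using sizes(1)[OF ij(1)] ij by simp
        then have "h1 i \<in> {0..<c1}" using bij_betw_apply[OF h1] by simp
        then show ?thesis using ij False r[OF i1] unfolding VQ by (simp add: f_def InrI)
      qed
    next
      fix w assume "w \<in> verts ?Q"
      then consider x j where "x < c0" "j < q" "w = Inl (x, j)" | x j where "x < c1" "j < r" "w = Inr (x, j)"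
        unfolding VQ by auto
      then show "w \<in> f ` verts ?P"
      proof cases
        case (1 x j)
        then have "x \<in> h0 ` ?I0" unfolding bij_betw_imp_surj_on[OF h0] by simp
        then obtain i where i: "i \<in> ?I0" "h0 i = x" by blast
        show ?thesis
          using 1 i by (intro image_eqI[of _ _ "(i, j)"]) (simp_all add: f_def verts_parent_forest)
      next
        case (2 x j)
        then have "x \<in> h1 ` ?I1" unfolding bij_betw_imp_surj_on[OF h1] by simp
        then obtain i where i: "i \<in> ?I1" "h1 i = x" by blast
        show ?thesis
          using 2 i r[OF i(1)]
          by (intro image_eqI[of _ _ "(i, j)"]) (simp_all add: f_def verts_parent_forest)
      qed
    qed
  qed
  have edge: "{(i, j), (i', k)} \<in> edges ?P \<longleftrightarrow> {f (i, j), f (i', k)} \<in> edges ?Q"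
    if v: "i < c" "j < m i" "i' < c" "k < m i'" for i j i' k
  proof -
    have P: "{(i, j), (i', k)} \<in> edges ?P \<longleftrightarrow> i = i' \<and> (k = Suc j \<or> j = Suc k)"
      using v by (auto simp: edge_parent_forest_iff)
    have lt: "h0 i < c0" if "m i = q" using bij_betw_apply[OF h0, of i] that v by simp
    have lt': "h1 i < c1" "m i = r" if "m i \<noteq> q"
      using bij_betw_apply[OF h1, of i] r[of i] sizes(1)[OF v(1)] that v by auto
    consider "m i = q" "m i' = q" | "m i \<noteq> q" "m i' \<noteq> q" | "(m i = q) \<noteq> (m i' = q)" by blast
    then show ?thesis
    proof cases
      case 1
      then have "{f (i, j), f (i', k)} \<in> edges ?Q \<longleftrightarrow> i = i' \<and> (k = Suc j \<or> j = Suc k)"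
        using v lt unfolding Q
        by (auto simp: f_def edge_disjoint_union_iff edge_copies_iff edge_path_graph_iff h0_inj)
      then show ?thesis using P by simp
    next
      case 2
      then have "{f (i, j), f (i', k)} \<in> edges ?Q \<longleftrightarrow> i = i' \<and> (k = Suc j \<or> j = Suc k)"
        using v lt' unfolding Q
        by (auto simp: f_def edge_disjoint_union_iff edge_copies_iff edge_path_graph_iff h1_inj)
      then show ?thesis using P by simp
    next
      case 3
      then have "{f (i, j), f (i', k)} \<notin> edges ?Q"
        unfolding Q by (auto simp: f_def edge_disjoint_union_iff)
      moreover have "i \<noteq> i'" using 3 by auto
      ultimately show ?thesis using P by simp
    qed
  qed
  show ?thesis
    unfolding graph_iso_def using bij edge
    by (intro exI[of _ f]) (auto simp: verts_parent_forest)
qed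

section \<open>Forests with the least distance spectral radius of the complement\<close>

text \<open>The chain runs from the forest through its parent form, the paths of the same orders, and the
  balanced paths. Equality of the two ends forces equality in each link, and each link is strict unless it
  is an isomorphism.\<close>

lemma forest_co_radius_minimal:
  assumes c: "c \<ge> 2" and F: "forest F" and n: "card (verts F) = n" and comp: "card (components F) = c"
  shows "co_radius (balanced_paths n c) \<le> co_radius F"
    and "co_radius F = co_radius (balanced_paths n c) \<longleftrightarrow> F \<cong>\<^sub>G balanced_paths n c"
proof -
  let ?Q = "balanced_paths n c"
  obtain m p where p: "parent_fun c m p" and m: "\<And>i. i < c \<Longrightarrow> m i \<ge> 1"
    and p2: "\<And>i j. i < c \<Longrightarrow> 0 < j \<Longrightarrow> j < m i \<Longrightarrow> p i j \<le> j - 2"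
    and iso: "F \<cong>\<^sub>G parent_forest c m p"
    using forest_iso_parent_forest[OF F comp] by blast
  let ?T = "parent_forest c m p" and ?C = "centred_path_forest c m" and ?P = "path_forest c m"
  have "card (verts F) = card (verts ?T)"
    using iso unfolding graph_iso_def by (blast intro: bij_betw_same_card)
  then have sum: "(\<Sum>i<c. m i) = n" using n by (simp add: card_parent_forest)
  have sF: "simple_graph F" using F by (simp add: forest_def)
  have T: "no_dominating_edge ?T" and C: "no_dominating_edge ?C" and P: "no_dominating_edge ?P"
    using p parent_fun_centred parent_fun_path c m by (auto intro: parent_forest_no_dominating_edge)
  have ndF: "no_dominating_edge F" by (rule no_dominating_edge_iso[OF T graph_iso_sym[OF iso] sF])
  obtain m' where m': "\<And>i. i < c \<Longrightarrow> m' i \<ge> 1" "(\<Sum>i<c. m' i) = n" "balanced c m'"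
    "m' = m \<or> co_radius (path_forest c m') < co_radius ?P"
    using balanced_path_forest_minimal[of c m, OF c m] unfolding sum by blast
  let ?B = "path_forest c m'"
  have B: "no_dominating_edge ?B" using parent_fun_path c m'(1) by (rule parent_forest_no_dominating_edge)
  have BQ: "?B \<cong>\<^sub>G ?Q" using balanced_path_forest_iso[of c m'] c m'(2,3) by simp
  have Q: "no_dominating_edge ?Q" by (rule no_dominating_edge_iso[OF B BQ simple_balanced_paths])
  have eqFT: "co_radius F = co_radius ?T" by (rule co_radius_iso[OF ndF T iso])
  have eqCP: "co_radius ?C = co_radius ?P" by (rule co_radius_iso[OF C P centred_path_forest_iso])
  have eqBQ: "co_radius ?B = co_radius ?Q" by (rule co_radius_iso[OF B Q BQ])
  have CT: "co_radius ?C \<le> co_radius ?T" by (rule centred_path_forest_minimal(1)[OF c m p p2])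
  have BP: "co_radius ?B \<le> co_radius ?P" using m'(4) by auto
  show "co_radius ?Q \<le> co_radius F" using eqFT eqCP eqBQ CT BP by simp
  show "co_radius F = co_radius ?Q \<longleftrightarrow> F \<cong>\<^sub>G ?Q"
  proof
    assume eq: "co_radius F = co_radius ?Q"
    have TC: "?T = ?C"
      by (rule centred_path_forest_minimal(2)[OF c m p p2]) (use eq eqFT eqCP eqBQ CT BP in simp_all)
    have "F \<cong>\<^sub>G ?P" using graph_iso_trans[OF iso[unfolded TC] centred_path_forest_iso] .
    moreover have "m' = m" using m'(4) eq eqFT eqCP eqBQ CT by auto
    ultimately show "F \<cong>\<^sub>G ?Q" using graph_iso_trans BQ by blast
  next
    assume "F \<cong>\<^sub>G ?Q"
    then show "co_radius F = co_radius ?Q" by (rule co_radius_iso[OF ndF Q])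
  qed
qed

theorem theorem3p2:
  fixes F G :: "'a sgraph" and n c :: nat
  assumes "c \<ge> 2"
    and "forest F"
    and "card (verts F) = n"
    and "card (components F) = c"
    and "G = graph_complement F"
  shows "distance_spectral_radius G \<ge> distance_spectral_radius (P_graph n c) \<and>
         (distance_spectral_radius G = distance_spectral_radius (P_graph n c) \<longleftrightarrow> G \<cong>\<^sub>G P_graph n c)"
proof -
  let ?Q = "balanced_paths n c"
  have P: "P_graph n c = graph_complement ?Q" by (simp add: P_graph_def balanced_paths_def)
  have sF: "simple_graph F" using assms(2) by (simp add: forest_def)
  have "G \<cong>\<^sub>G P_graph n c \<longleftrightarrow> F \<cong>\<^sub>G ?Q"
    using graph_iso_complement[of F ?Q] graph_iso_complement[of G "P_graph n c"]
    unfolding assms(5) P complement_complement[OF sF] complement_complement[OF simple_balanced_paths]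
    by blast
  then show ?thesis
    using forest_co_radius_minimal[OF assms(1-4)] unfolding P assms(5) co_radius_def by simp
qed

end
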